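(* Consider the full-information maintenance Markov decision process with machine set $\mathcal{M}=\{1,\ldots,M\}$ defined in the context, and let $Q(\cdot,\cdot)$ denote the state-action value function of an optimal policy. Let $x=(x_1,\lambda_1,\phi_1,\ldots,x_M,\lambda_M,\phi_M)$ be a state, let $a^*(x)\in\mathcal{U}(x)$ be an optimal action in state $x$, i.e. $a^*(x)\in\arg\min_{a\in\mathcal{U}(x)}Q(x,a)$, and let $\mathcal{M}(x)=\{m\in\mathcal{M} : a^*_m(x)=1\}$ be the set of machines maintained under this optimal action. Let $x'=(x_1,\lambda'_1,\phi'_1,\ldots,x_M,\lambda'_M,\phi'_M)$ be any state with the same degradation levels as $x$ such that 1. $\lambda'_m\ge\lambda_m$ and $\phi'_m\ge\phi_m$ for all $m\in\mathcal{M}(x)$, and 2. $\lambda'_m=\lambda_m$ and $\phi'_m=\phi_m$ for all $m\in\mathcal{M}\setminus\mathcal{M}(x)$. Suppose that $\phi'_m\ge\phi_m$ implies $Y'_m\ge_{\mathrm{st}}Y_m$, where $Y'_m$ and $Y_m$ are random variables having the shock size distribution of machine $m$ with parameter $\phi'_m$ and $\phi_m$, respectively. Then $$a^*(x)\in\arg\min_{a\in\mathcal{U}(x')}Q(x',a).$$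
   Context: **Stochastic order.** For random variables $X,Y$, $X\le_{\mathrm{st}}Y$ (equivalently $Y\ge_{\mathrm{st}}X$) means $\mathbb{P}(X>u)\le\mathbb{P}(Y>u)$ for all $u\in\mathbb{R}$. **Model.** There are $M$ machines, $\mathcal{M}=\{1,\ldots,M\}$. Machine $m$ has a failure threshold $\xi_m>0$, a preventive replacement cost $c_m^{\mathrm{PM}}$ and a corrective replacement cost $c_m^{\mathrm{CM}}$ with $0<c_m^{\mathrm{PM}}<c_m^{\mathrm{CM}}<\infty$. There is a shared setup cost $c^{\mathrm{ST}}\ge 0$ and a discount factor $\gamma\in[0,1)$. For each $m$, $\Lambda_m$ and $\Phi_m$ are given (known) probability distributions on, respectively, the set $\mathbb{R}_+$ of shock rates and the set of shock-size parameters. *Degradation.* While its parameters are $(\lambda_m,\phi_m)$, machine $m$ accumulates damage according to a compound Poisson process: shocks arrive by a Poisson process of rate $\lambda_m$, and the shock sizes are i.i.d. non-negative random variables, independent of the arrivals, with density or mass function from a one-parameter exponential family with linear sufficient statistic, $f_m(x\mid\phi_m)=h_m(x)e^{\phi_m x-A_m(\phi_m)}$, where $h_m$ and $A_m$ are known functions. Machines degrade independently of each other. *States.* A state is a vector $h=(x_1,\lambda_1,\phi_1,\ldots,x_M,\lambda_M,\phi_M)$, where $x_m\ge 0$ is the degradation level of machine $m$ and $\lambda_m,\phi_m$ are its current (observed) degradation parameters. Machine $m$ is failed if $x_m\ge\xi_m$. *Actions.* At each decision epoch $t=0,1,2,\ldots$ an action $a=(a_1,\ldots,a_M)\in\mathcal{U}(h)=\mathcal{U}_1(h)\times\cdots\times\mathcal{U}_M(h)$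 is chosen, where $\mathcal{U}_m(h)=\{0,1\}$ if $x_m<\xi_m$ and $\mathcal{U}_m(h)=\{1\}$ if $x_m\ge\xi_m$; $a_m=1$ means that machine $m$ is maintained (replaced). *Costs.* $$C(h,a)=c^{\mathrm{ST}}\mathbf{1}_{\{\sum_{m}a_m>0\}}+\sum_{m\in\mathcal{M}}\left(c_m^{\mathrm{CM}}\mathbf{1}_{\{a_m=1,\,x_m\ge\xi_m\}}+c_m^{\mathrm{PM}}\mathbf{1}_{\{a_m=1,\,x_m<\xi_m\}}\right).$$ *Transitions.* Given $h$ and $a$: for every $m$ with $a_m=1$, instantaneously the degradation level is reset to $0$ and new parameters $\lambda_m,\phi_m$ are drawn independently from $\Lambda_m$ and $\Phi_m$; for every $m$ with $a_m=0$ the level and parameters are unchanged. Then each machine, independently, accumulates one time unit of compound Poisson damage with its current parameters, which is added to its level; the parameters stay fixed. The resulting random state is denoted $\hat{h}(a)$. *Values.* $V(h)$ is the minimum over all policies of the total expected discounted cost $\mathbb{E}\big[\sum_{t=0}^\infty\gamma^t C(h(t),a(t))\mid h(0)=h\big]$, and $Q(h,a)=C(h,a)+\gamma\,\mathbb{E}[V(\hat{h}(a))]$ for $a\in\mathcal{U}(h)$, so that $V(h)=\min_{a\in\mathcal{U}(h)}Q(h,a)$. *)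

theory Defs
  imports "HOL-Probability.Probability"
begin

section \<open>Model data\<close>

text \<open>Machines are the elements of a finite type \<open>'m\<close>.  The state of one machine is a triple
  (degradation level, shock rate, shock-size parameter).  An action \<open>a\<close> is the 0/1 vector with
  \<open>a m = True\<close> iff machine \<open>m\<close> is maintained.\<close>

type_synonym machine_state = "real \<times> real \<times> real"
type_synonym 'm state = "'m \<Rightarrow> machine_state"
type_synonym 'm action = "'m \<Rightarrow> bool"

abbreviation level :: "'m state \<Rightarrow> 'm \<Rightarrow> real" where "level h m \<equiv> fst (h m)"
abbreviation rate :: "'m state \<Rightarrow> 'm \<Rightarrow> real" where "rate h m \<equiv> fst (snd (h m))"
abbreviation param :: "'m state \<Rightarrow> 'm \<Rightarrow> real" where "param h m \<equiv> snd (snd (h m))"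

record 'm maintenance_data =
  threshold :: "'m \<Rightarrow> real"
  pm_cost :: "'m \<Rightarrow> real"
  cm_cost :: "'m \<Rightarrow> real"
  setup_cost :: real
  discount :: real
  rate_dist :: "'m \<Rightarrow> real measure"              \<comment> \<open>\<open>\<Lambda>\<^sub>m\<close>\<close>
  param_dist :: "'m \<Rightarrow> real measure"             \<comment> \<open>\<open>\<Phi>\<^sub>m\<close>\<close>
  param_set :: "'m \<Rightarrow> real set"                  \<comment> \<open>admissible shock-size parameters\<close>
  ref_measure :: "'m \<Rightarrow> real measure"            \<comment> \<open>dominating measure of \<open>f\<^sub>m\<close>\<close>
  base_fun :: "'m \<Rightarrow> real \<Rightarrow> real"               \<comment> \<open>\<open>h\<^sub>m\<close>\<close>
  log_partition :: "'m \<Rightarrow> real \<Rightarrow> real"          \<comment> \<open>\<open>A\<^sub>m\<close>\<close>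


section \<open>Damage distributions\<close>

definition nonneg_borel :: "real measure" where
  "nonneg_borel = restrict_space borel {0..}"

definition shock_density :: "'m maintenance_data \<Rightarrow> 'm \<Rightarrow> real \<Rightarrow> real \<Rightarrow> real" where
  "shock_density P m \<phi> y = base_fun P m y * exp (\<phi> * y - log_partition P m \<phi>)"

definition shock_dist :: "'m maintenance_data \<Rightarrow> 'm \<Rightarrow> real \<Rightarrow> real measure" where
  "shock_dist P m \<phi> = density (ref_measure P m) (\<lambda>y. ennreal (shock_density P m \<phi> y))"

text \<open>\<^const>\<open>poisson_pmf\<close> is only specified for positive rates; rate \<open>0\<close> means no shocks.\<close>

definition shock_count_pmf :: "real \<Rightarrow> nat pmf" where
  "shock_count_pmf l = (if l = 0 then return_pmf 0 else poisson_pmf l)"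

text \<open>Law of the damage accumulated in one time unit by a compound Poisson process with rate \<open>l\<close>
  and shock-size law \<open>\<nu>\<close>.\<close>

definition compound_poisson :: "real \<Rightarrow> real measure \<Rightarrow> real measure" where
  "compound_poisson l \<nu> =
     measure_pmf (shock_count_pmf l) \<bind>
       (\<lambda>n. distr (PiM {..<n} (\<lambda>_. \<nu>)) nonneg_borel (\<lambda>y. \<Sum>i<n. y i))"

definition st_le :: "'a measure \<Rightarrow> ('a \<Rightarrow> real) \<Rightarrow> 'b measure \<Rightarrow> ('b \<Rightarrow> real) \<Rightarrow> bool" where
  "st_le M X N Y \<longleftrightarrow>
     (\<forall>u. measure M {\<omega>\<in>space M. X \<omega> > u} \<le> measure N {\<omega>\<in>space N. Y \<omega> > u})"


section \<open>Standing assumptions\<close>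

text \<open>The dominating measure of the shock sizes is either Lebesgue measure on the half-line
  (\<open>f\<^sub>m\<close> is a density) or the counting measure on a countable set of non-negative reals
  (\<open>f\<^sub>m\<close> is a mass function).\<close>

locale maintenance_mdp =
  fixes P :: "'m::finite maintenance_data"
  assumes threshold_pos: "\<And>m. 0 < threshold P m"
    and pm_cost_pos: "\<And>m. 0 < pm_cost P m"
    and pm_less_cm: "\<And>m. pm_cost P m < cm_cost P m"
    and setup_cost_nonneg: "0 \<le> setup_cost P"
    and discount_nonneg: "0 \<le> discount P"
    and discount_less_1: "discount P < 1"
    and param_set_borel: "\<And>m. param_set P m \<in> sets borel"
    and prob_space_rate_dist: "\<And>m. prob_space (rate_dist P m)"
    and sets_rate_dist: "\<And>m. sets (rate_dist P m) = sets nonneg_borel"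
    and prob_space_param_dist: "\<And>m. prob_space (param_dist P m)"
    and sets_param_dist: "\<And>m. sets (param_dist P m) = sets (restrict_space borel (param_set P m))"
    and ref_measure: "\<And>m. ref_measure P m = restrict_space lborel {0..} \<or>
          (\<exists>D\<subseteq>{0..}. countable D \<and> ref_measure P m = distr (count_space D) nonneg_borel (\<lambda>y. y))"
    and base_fun_measurable: "\<And>m. base_fun P m \<in> borel_measurable nonneg_borel"
    and base_fun_nonneg: "\<And>m y. 0 \<le> y \<Longrightarrow> 0 \<le> base_fun P m y"
    and prob_space_shock_dist: "\<And>m \<phi>. \<phi> \<in> param_set P m \<Longrightarrow> prob_space (shock_dist P m \<phi>)"


section \<open>The decision process\<close>

definition machine_space :: "'m maintenance_data \<Rightarrow> 'm \<Rightarrow> machine_state measure" where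
  "machine_space P m =
     nonneg_borel \<Otimes>\<^sub>M (nonneg_borel \<Otimes>\<^sub>M restrict_space borel (param_set P m))"

definition state_space :: "'m maintenance_data \<Rightarrow> 'm state measure" where
  "state_space P = PiM UNIV (machine_space P)"

definition actions :: "'m maintenance_data \<Rightarrow> 'm state \<Rightarrow> 'm action set" where
  "actions P h = {a. \<forall>m. threshold P m \<le> level h m \<longrightarrow> a m}"

definition cost :: "'m::finite maintenance_data \<Rightarrow> 'm state \<Rightarrow> 'm action \<Rightarrow> real" where
  "cost P h a =
     setup_cost P * of_bool (\<exists>m. a m) +
     (\<Sum>m\<in>UNIV. cm_cost P m * of_bool (a m \<and> threshold P m \<le> level h m) +
                pm_cost P m * of_bool (a m \<and> level h m < threshold P m))"

text \<open>A transition is an instantaneous reset (or no change) followed by one time unit of damage.\<close>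

definition reset_dist :: "'m maintenance_data \<Rightarrow> 'm \<Rightarrow> machine_state \<Rightarrow> bool \<Rightarrow> machine_state measure"
  where
  "reset_dist P m s b =
     (if b then distr (rate_dist P m \<Otimes>\<^sub>M param_dist P m) (machine_space P m) (\<lambda>(l, \<phi>). (0, l, \<phi>))
      else return (machine_space P m) s)"

definition degrade :: "'m maintenance_data \<Rightarrow> 'm \<Rightarrow> machine_state \<Rightarrow> machine_state measure" where
  "degrade P m = (\<lambda>(y, l, \<phi>).
     distr (compound_poisson l (shock_dist P m \<phi>)) (machine_space P m) (\<lambda>d. (y + d, l, \<phi>)))"

definition next_state :: "'m maintenance_data \<Rightarrow> 'm state \<Rightarrow> 'm action \<Rightarrow> 'm state measure" where
  "next_state P h a = PiM UNIV (\<lambda>m. reset_dist P m (h m) (a m) \<bind> degrade P m)"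


section \<open>Policies and values\<close>

text \<open>Policies are history-dependent and may randomise: \<open>\<pi> t w h\<close> is the law of the action at
  epoch \<open>t\<close> given the earlier state-action pairs \<open>w 0, \<dots>, w (t - 1)\<close> and the current state \<open>h\<close>.\<close>

type_synonym 'm policy = "nat \<Rightarrow> (nat \<Rightarrow> 'm state \<times> 'm action) \<Rightarrow> 'm state \<Rightarrow> 'm action pmf"

definition step_space :: "'m maintenance_data \<Rightarrow> ('m state \<times> 'm action) measure" where
  "step_space P = state_space P \<Otimes>\<^sub>M count_space UNIV"

abbreviation history_space ::
    "'m maintenance_data \<Rightarrow> nat \<Rightarrow> (nat \<Rightarrow> 'm state \<times> 'm action) measure" where
  "history_space P t \<equiv> PiM {0..<t} (\<lambda>_. step_space P)"

definition policies :: "'m maintenance_data \<Rightarrow> 'm policy set" where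
  "policies P = {\<pi>. \<forall>t.
     (\<forall>a. (\<lambda>(w, h). pmf (\<pi> t w h) a) \<in> borel_measurable (history_space P t \<Otimes>\<^sub>M state_space P)) \<and>
     (\<forall>w\<in>space (history_space P t). \<forall>h\<in>space (state_space P). set_pmf (\<pi> t w h) \<subseteq> actions P h)}"

text \<open>Conditional law of the state-action pair at epoch \<open>t\<close> given the history, started in \<open>h\<^sub>0\<close>.\<close>

definition step_kernel ::
    "'m maintenance_data \<Rightarrow> 'm policy \<Rightarrow> 'm state \<Rightarrow> nat \<Rightarrow> (nat \<Rightarrow> 'm state \<times> 'm action) \<Rightarrow>
     ('m state \<times> 'm action) measure" where
  "step_kernel P \<pi> h\<^sub>0 t w =
     (case t of 0 \<Rightarrow> return (state_space P) h\<^sub>0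
              | Suc s \<Rightarrow> next_state P (fst (w s)) (snd (w s))) \<bind>
     (\<lambda>h. distr (measure_pmf (\<pi> t w h)) (step_space P) (\<lambda>a. (h, a)))"

text \<open>Law of the whole trajectory \<open>t \<mapsto> (h(t), a(t))\<close>: the Ionescu-Tulcea limit of the kernels.\<close>

definition trajectory ::
    "'m maintenance_data \<Rightarrow> 'm policy \<Rightarrow> 'm state \<Rightarrow> (nat \<Rightarrow> 'm state \<times> 'm action) measure" where
  "trajectory P \<pi> h\<^sub>0 =
     projective_family.lim UNIV (Ionescu_Tulcea.CI (step_kernel P \<pi> h\<^sub>0) (\<lambda>_. step_space P))
       (\<lambda>_. step_space P)"

definition policy_cost :: "'m::finite maintenance_data \<Rightarrow> 'm policy \<Rightarrow> 'm state \<Rightarrow> real" where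
  "policy_cost P \<pi> h\<^sub>0 =
     (\<integral>\<omega>. (\<Sum>t. discount P ^ t * cost P (fst (\<omega> t)) (snd (\<omega> t))) \<partial>trajectory P \<pi> h\<^sub>0)"

text \<open>Stage costs are non-negative and bounded and \<open>discount P < 1\<close>, so the infimum is a real number
  in the intended sense.\<close>

definition V :: "'m::finite maintenance_data \<Rightarrow> 'm state \<Rightarrow> real" where
  "V P h = (INF \<pi>\<in>policies P. policy_cost P \<pi> h)"

definition Q :: "'m::finite maintenance_data \<Rightarrow> 'm state \<Rightarrow> 'm action \<Rightarrow> real" where
  "Q P h a = cost P h a + discount P * (\<integral>h'. V P h' \<partial>next_state P h a)"

abbreviation optimal_action ::
    "'m::finite maintenance_data \<Rightarrow> 'm state \<Rightarrow> 'm action \<Rightarrow> bool" where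
  "optimal_action P h \<equiv> is_arg_min (Q P h) (\<lambda>a. a \<in> actions P h)"

end

theory Submission
  imports Defs
begin

text \<open>A maintained machine forgets its parameters, so \<open>Q x' a = Q x a\<close> for the optimal action \<open>a\<close>; it
  remains to see that \<open>Q x b \<le> Q x' b\<close> for every other action \<open>b\<close>.  Larger rates and stochastically
  larger shocks give stochastically larger compound Poisson damage, while larger levels
  shrink the action sets and raise the costs, so every value iterate is monotone, and hence so is its
  limit.  That limit is \<open>V\<close>: it bounds the cost of every history-dependent policy from below (by
  unrolling the trajectory law one step at a time) and is attained by a measurable greedy selector.
  Values are taken in \<^typ>\<open>ennreal\<close>, which avoids all integrability side conditions.\<close>

section \<open>Stochastic dominance and product kernels\<close>

text \<open>The critical rivals are actions \<open>b\<close> that keep a machine which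
  \<open>a\<close> replaces: there the larger parameters survive into the next state and act until
  the next replacement. A one-step comparison of damage is therefore not enough; the continuation
  value must be monotone in levels and parameters together. So the order on states has to contain
  the parameters, and every transition has to preserve the expectation inequality for all functions
  monotone in that order. A second obstacle is that \<open>V\<close> is an infimum of Bochner
  integrals over all randomised history-dependent policies, so neither its measurability nor its
  monotonicity can be read off. Coupling two trajectories would require translating policies between
  states with different histories and action sets. Value iteration avoids this, because monotonicity
  passes through each Bellman step and through the supremum. The iteration starts at 0 so that the
  iterates increase: monotone convergence then exchanges limit and expectation, and finiteness of
  the action set exchanges limit and minimum.\<close>

lemma measurable_PiM_prob_kernel:
  assumes I: "finite I" and K: "\<And>i. K i \<in> M \<rightarrow>\<^sub>M prob_algebra (N i)"
  shows "(\<lambda>x. PiM I (\<lambda>i. K i x)) \<in> M \<rightarrow>\<^sub>M prob_algebra (PiM I N)"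
proof (rule measurable_prob_algebra_generated[OF sets_PiM Int_stable_prod_algebra
    prod_algebra_sets_into_space])
  fix x assume x: "x \<in> space M"
  have K': "prob_space (K i x)" "sets (K i x) = sets (N i)" for i
    using measurable_space[OF K x, of i] by (auto simp: space_prob_algebra)
  show "prob_space (PiM I (\<lambda>i. K i x))"
    by (rule prob_space_PiM) (rule K')
  show "sets (PiM I (\<lambda>i. K i x)) = sets (PiM I N)"
    by (rule sets_PiM_cong) (auto simp: K')
next
  \<comment> \<open>Boxes are a generator closed under intersection, and the mass of a box is a
    finite product of functions already known to be measurable.\<close>
  fix A assume "A \<in> prod_algebra I N"
  then obtain X where A: "A = Pi\<^sub>E I X" and X: "\<And>i. i \<in> I \<Longrightarrow> X i \<in> sets (N i)"
    by (auto simp: prod_algebra_eq_finite[OF I])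
  have "(\<lambda>x. \<Prod>i\<in>I. emeasure (K i x) (X i)) \<in> borel_measurable M"
    using K[THEN measurable_prob_algebraD]
    by (intro borel_measurable_prod_ennreal measurable_emeasure_kernel) (auto intro: X)
  moreover have "emeasure (PiM I (\<lambda>i. K i x)) A = (\<Prod>i\<in>I. emeasure (K i x) (X i))" if x: "x
      \<in> space M" for x
  proof -
    have K': "prob_space (K i x)" "sets (K i x) = sets (N i)" for i
      using measurable_space[OF K x, of i] by (auto simp: space_prob_algebra)
    interpret product_sigma_finite "\<lambda>i. K i x"
      by (simp add: product_sigma_finite_def prob_space_imp_sigma_finite K')
    show ?thesis
      unfolding A using I X by (intro emeasure_PiM) (auto simp: K')
  qed
  ultimately show "(\<lambda>x. emeasure (PiM I (\<lambda>i. K i x)) A) \<in> borel_measurable M"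
    by (simp cong: measurable_cong)
qed

text \<open>The factors are exchanged one at a time. \<open>R i\<close> need not be an order:
  reflexivity is enough, since points that differ in one coordinate only must be comparable. It is
  instantiated with \<open>\<le>\<close> on shock sizes and with \<open>machine_le\<close> on
  machines.\<close>

lemma nn_integral_PiM_mono_coordinates:
  fixes M N S :: "'i \<Rightarrow> 'a measure"
  assumes I: "finite I"
    and M: "\<And>i. prob_space (M i)" "\<And>i. sets (M i) = sets (S i)"
    and N: "\<And>i. prob_space (N i)" "\<And>i. sets (N i) = sets (S i)"
    and R: "\<And>i x. R i x x"
    and dom: "\<And>i g. i \<in> I \<Longrightarrow> g \<in> borel_measurable (S i) \<Longrightarrow>
        (\<And>x y. x \<in> space (S i) \<Longrightarrow> y \<in> space (S i) \<Longrightarrow> R i x y \<Longrightarrow> g x \<le> (g y :: ennreal)) \<Longrightarrow>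
        (\<integral>\<^sup>+x. g x \<partial>M i) \<le> (\<integral>\<^sup>+x. g x \<partial>N i)"
    and f: "f \<in> borel_measurable (PiM I S)"
    and mono: "\<And>x y. x \<in> space (PiM I S) \<Longrightarrow> y \<in> space (PiM I S) \<Longrightarrow>
        (\<And>i. i \<in> I \<Longrightarrow> R i (x i) (y i)) \<Longrightarrow> f x \<le> (f y :: ennreal)"
  shows "(\<integral>\<^sup>+x. f x \<partial>PiM I M) \<le> (\<integral>\<^sup>+x. f x \<partial>PiM I N)"
  using I dom f mono
proof (induction I arbitrary: f rule: finite_induct)
  case empty
  have "PiM {} M = PiM {} N" by (simp add: PiM_empty)
  then show ?case by simp
next
  case (insert j J)
  interpret M: product_sigma_finite M
    by (simp add: product_sigma_finite_def prob_space_imp_sigma_finite M)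
  interpret N: product_sigma_finite N
    by (simp add: product_sigma_finite_def prob_space_imp_sigma_finite N)
  have fM: "f \<in> borel_measurable (PiM (insert j J) M)" and fN: "f
      \<in> borel_measurable (PiM (insert j J) N)"
    using insert.prems(2) by (simp_all cong: measurable_cong_sets sets_PiM_cong add: M N)
  have space: "space (PiM J M) = space (PiM J S)" "space (PiM J N) = space (PiM J S)"
       "\<And>i. space (M i) = space (S i)"  "\<And>i. space (N i) = space (S i)"
    using M(2)[THEN sets_eq_imp_space_eq] N(2)[THEN sets_eq_imp_space_eq] by (simp_all add: space_PiM)
  have upd: "x(j := y) \<in> space (PiM (insert j J) S)" if "x \<in> space (PiM J S)" "y \<in> space (S j)" for x y
    using that by (auto simp: space_PiM PiE_iff extensional_def)
  have step: "(\<integral>\<^sup>+y. f (x(j := y)) \<partial>M j) \<le> (\<integral>\<^sup>+y. f (x(j := y)) \<partial>N j)" if x: "x \<in> space (PiM J S)" for x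
  proof (rule insert.prems(1))
    show "(\<lambda>y. f (x(j := y))) \<in> borel_measurable (S j)"
      by (rule measurable_compose[OF measurable_component_update insert.prems(2), OF x insert.hyps(2)])
  qed (use x R upd insert.hyps in \<open>auto intro!: insert.prems(3)\<close>)
  have "(\<integral>\<^sup>+x. f x \<partial>PiM (insert j J) M) = (\<integral>\<^sup>+x. \<integral>\<^sup>+y. f (x(j := y)) \<partial>M j \<partial>PiM J M)"
    by (intro M.product_nn_integral_insert insert.hyps fM)
  also have "\<dots> \<le> (\<integral>\<^sup>+x. \<integral>\<^sup>+y. f (x(j := y)) \<partial>N j \<partial>PiM J M)"
    by (intro nn_integral_mono step) (simp add: space)
  also have "\<dots> \<le> (\<integral>\<^sup>+x. \<integral>\<^sup>+y. f (x(j := y)) \<partial>N j \<partial>PiM J N)"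
  proof (rule insert.IH)
    have "(\<lambda>(x, y). f (x(j := y))) \<in> borel_measurable (PiM J S \<Otimes>\<^sub>M S j)"
      using measurable_comp[OF measurable_add_dim insert.prems(2)]
          by (simp add: comp_def case_prod_beta')
    then show "(\<lambda>x. \<integral>\<^sup>+y. f (x(j := y)) \<partial>N j) \<in> borel_measurable (PiM J S)"
      by (intro sigma_finite_measure.borel_measurable_nn_integral prob_space_imp_sigma_finite N)
         (simp cong: measurable_cong_sets sets_pair_measure_cong add: N)
  next
    fix x y assume "x \<in> space (PiM J S)" "y \<in> space (PiM J S)" "\<And>i. i \<in> J \<Longrightarrow> R i (x i) (y i)"
    then show "(\<integral>\<^sup>+z. f (x(j := z)) \<partial>N j) \<le> (\<integral>\<^sup>+z. f (y(j := z)) \<partial>N j)"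
      using R by (intro nn_integral_mono insert.prems(3) upd) (auto simp: space)
  qed (use insert.prems in auto)
  also have "\<dots> = (\<integral>\<^sup>+x. f x \<partial>PiM (insert j J) N)"
    by (intro N.product_nn_integral_insert[symmetric] insert.hyps fN)
  finally show ?case .
qed

text \<open>The quantile functions of two stochastically ordered laws couple them monotonically.\<close>

lemma st_le_imp_nn_integral_le:
  assumes M: "prob_space M" "X \<in> borel_measurable M" and N: "prob_space N" "Y \<in> borel_measurable N"
    and le: "st_le M X N Y"
    and g: "g \<in> borel_measurable borel" "mono (g :: real \<Rightarrow> ennreal)"
  shows "(\<integral>\<^sup>+\<omega>. g (X \<omega>) \<partial>M) \<le> (\<integral>\<^sup>+\<omega>. g (Y \<omega>) \<partial>N)"
proof -
  interpret M: cdf_distribution "distr M borel X"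
    using M by (simp add: cdf_distribution_def prob_space.real_distribution_distr)
  interpret N: cdf_distribution "distr N borel Y"
    using N by (simp add: cdf_distribution_def prob_space.real_distribution_distr)
  let ?\<Omega> = "restrict_space lborel {0<..<1::real}"
  have cdf: "cdf (distr M borel X) u = 1 - measure M {\<omega>\<in>space M. X \<omega> > u}"
    if "prob_space M" "X \<in> borel_measurable M" for M :: "'c measure" and X u
  proof -
    interpret prob_space M by fact
    have "X -` {..u} \<inter> space M = space M - {\<omega>\<in>space M. X \<omega> > u}" by auto
    then show ?thesis
      using that by (simp add: cdf_def measure_distr prob_compl)
  qed
  have cdf_le: "N.C u \<le> M.C u" for u
    using le by (simp add: cdf M N st_le_def)
  \<comment> \<open>On the open unit interval the pseudoinverse satisfies \<open>I w \<le> u\<close>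
    iff \<open>w \<le> C u\<close>, so the smaller distribution function has the larger
    quantiles.\<close>
  have I_le: "M.I w \<le> N.I w" if w: "w \<in> {0<..<1}" for w
  proof -
    have "w \<le> N.C (N.I w)"
      using N.pseudoinverse[of w "N.I w"] w by auto
    also have "\<dots> \<le> M.C (N.I w)" by (rule cdf_le)
    finally show ?thesis
      using M.pseudoinverse[of w "N.I w"] w by auto
  qed
  have quant: "(\<integral>\<^sup>+\<omega>. g (X \<omega>) \<partial>M) = (\<integral>\<^sup>+w. g (Inf {x. w \<le> cdf (distr M borel X) x}) \<partial>?\<Omega>)"
    if "prob_space M" "X \<in> borel_measurable M" for M :: "'c measure" and X
  proof -
    interpret cdf_distribution "distr M borel X"
      using that by (simp add: cdf_distribution_def prob_space.real_distribution_distr)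
    have "(\<integral>\<^sup>+\<omega>. g (X \<omega>) \<partial>M) = (\<integral>\<^sup>+x. g x \<partial>distr M borel X)"
      using that g by (simp add: nn_integral_distr)
    also have "\<dots> = (\<integral>\<^sup>+x. g x \<partial>distr ?\<Omega> borel I)"
      by (simp only: distr_I_eq_M)
    also have "\<dots> = (\<integral>\<^sup>+w. g (I w) \<partial>?\<Omega>)"
      using g measurable_CI by (intro nn_integral_distr)
          (auto cong: measurable_cong_sets sets_restrict_space_cong)
    finally show ?thesis .
  qed
  show ?thesis
    unfolding quant[OF M] quant[OF N]
    by (intro nn_integral_mono monoD[OF g(2)] I_le) (simp add: space_restrict_space)
qed

section \<open>Compound Poisson damage\<close>

lemma space_nonneg_borel [simp]: "space nonneg_borel = {0..}"
  by (simp add: nonneg_borel_def space_restrict_space)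

lemma measurable_nonneg_borel_iff:
  "f \<in> M \<rightarrow>\<^sub>M nonneg_borel \<longleftrightarrow> f \<in> borel_measurable M \<and> (\<forall>x\<in>space M. 0 \<le> f x)"
  by (auto simp: nonneg_borel_def measurable_restrict_space2_iff Pi_iff)

lemma measurable_from_nonneg_borel:
  "f \<in> M \<rightarrow>\<^sub>M nonneg_borel \<Longrightarrow> f \<in> borel_measurable M"
  by (simp add: measurable_nonneg_borel_iff)

lemma measurable_sum_nonneg_borel:
  fixes n :: nat
  shows "(\<lambda>y. \<Sum>i<n. y i) \<in> PiM {..<n} (\<lambda>_. nonneg_borel) \<rightarrow>\<^sub>M nonneg_borel"
proof -
  have "(\<lambda>y. y i) \<in> borel_measurable (PiM {..<n} (\<lambda>_. nonneg_borel))" if "i < n" for i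
    using that by (intro measurable_from_nonneg_borel measurable_component_singleton) simp
  then show ?thesis
    by (auto simp: measurable_nonneg_borel_iff space_PiM PiE_iff intro!: sum_nonneg borel_measurable_sum)
qed

section \<open>Poisson shock counts ordered by their rate\<close>

text \<open>With \<open>0 ^ 0 = 1\<close> the Poisson formula also covers rate 0, so later arguments
  need no case split.\<close>

lemma pmf_shock_count: "0 \<le> l \<Longrightarrow> pmf (shock_count_pmf l) k = l ^ k / fact k * exp (- l)"
  by (cases k) (auto simp: shock_count_pmf_def indicator_def)

text \<open>Differentiating the \<open>j\<close>-th weight in the rate gives the previous weight
  minus the \<open>j\<close>-th one. The sum telescopes, and the derivative of the distribution
  function is minus its last weight.\<close>

lemma poisson_cdf_antimono:
  assumes "0 \<le> l" "l \<le> l'"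
  shows "(\<Sum>j\<le>k. l' ^ j / fact j * exp (- l')) \<le> (\<Sum>j\<le>k. l ^ j / fact j * exp (- l :: real))"
proof (rule DERIV_nonpos_imp_nonincreasing[OF assms(2)])
  fix t assume "l \<le> t" "t \<le> l'"
  have "((\<lambda>l. \<Sum>j\<le>k. l ^ j / fact j * exp (- l)) has_real_derivative - (t ^ k / fact k * exp (- t)))
      (at t)"
  proof (induction k)
    case 0
    show ?case by (auto intro!: derivative_eq_intros)
  next
    case (Suc k)
    have "((\<lambda>l. l ^ Suc k / fact (Suc k) * exp (- l)) has_real_derivative
        t ^ k / fact k * exp (- t) - t ^ Suc k / fact (Suc k) * exp (- t)) (at t)"
    proof -
      have "((\<lambda>l. l ^ Suc k / fact (Suc k)) has_real_derivative t ^ k / fact k) (at t)"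
        using DERIV_cdivide[OF DERIV_pow[of "Suc k" t UNIV], of "fact (Suc k)"]
        by (simp del: of_nat_Suc power_Suc)
      moreover have "((\<lambda>l. exp (- l)) has_real_derivative - exp (- t)) (at t)"
        by (auto intro!: derivative_eq_intros)
      ultimately show ?thesis
        by (rule DERIV_cong[OF DERIV_mult]) (simp add: algebra_simps)
    qed
    from DERIV_add[OF Suc this] show ?case by simp
  qed
  then show "\<exists>y. ((\<lambda>l. \<Sum>j\<le>k. l ^ j / fact j * exp (- l)) has_real_derivative y) (at t) \<and> y \<le> 0"
    using assms \<open>l \<le> t\<close> by (intro exI conjI) auto
qed

lemma st_le_shock_count:
  assumes "0 \<le> l" "l \<le> l'"
  shows "st_le (shock_count_pmf l) real (shock_count_pmf l') real"
  unfolding st_le_def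
proof
  fix u :: real
  show "measure (shock_count_pmf l) {n \<in> space (shock_count_pmf l). u < real n}
      \<le> measure (shock_count_pmf l') {n \<in> space (shock_count_pmf l'). u < real n}"
  proof (cases "u < 0")
    case True
    then have "{n. u < real n} = UNIV" by (auto intro: less_le_trans)
    then show ?thesis by simp
  next
    case False
    then have *: "{n. u < real n} = space (measure_pmf p) - {..nat \<lfloor>u\<rfloor>}" for p :: "nat pmf"
      by (auto simp: le_nat_floor not_le) linarith+
    have "measure (shock_count_pmf r) {n. u < real n} =
        1 - (\<Sum>j\<le>nat \<lfloor>u\<rfloor>. r ^ j / fact j * exp (- r))" if "0 \<le> r" for r
      unfolding *[of "shock_count_pmf r"] using that
      by (subst measure_pmf.prob_compl) (auto simp: measure_measure_pmf_finite pmf_shock_count)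
    then show ?thesis
      using assms poisson_cdf_antimono[OF assms, of "nat \<lfloor>u\<rfloor>"] by simp
  qed
qed

lemma nn_integral_shock_count_mono:
  fixes G :: "nat \<Rightarrow> ennreal"
  assumes "0 \<le> l" "l \<le> l'" "mono G"
  shows "(\<integral>\<^sup>+n. G n \<partial>shock_count_pmf l) \<le> (\<integral>\<^sup>+n. G n \<partial>shock_count_pmf l')"
proof -
  \<comment> \<open>The coupling lemma speaks of functions on the reals, so \<open>G\<close> is
    extended by \<open>nat \<lfloor>x\<rfloor>\<close>, which is monotone even across 0 because
    \<open>nat\<close> cuts negative integers off at 0.\<close>
  have "mono (\<lambda>x::real. G (nat \<lfloor>x\<rfloor>))"
    by (intro monoI monoD[OF assms(3)] nat_mono floor_mono)
  then have "(\<integral>\<^sup>+n. G (nat \<lfloor>real n\<rfloor>) \<partial>shock_count_pmf l) \<le> (\<integral>\<^sup>+n. G (nat \<lfloor>real n\<rfloor>) \<partial>shock_count_pmf l')"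
    by (intro st_le_imp_nn_integral_le st_le_shock_count assms measure_pmf.prob_space_axioms) measurable
  then show ?thesis by simp
qed

section \<open>Random sums of shocks\<close>

text \<open>Conditional mean given exactly \<open>n\<close> shocks. It separates the two sources of
  randomness, so that the shock law and the rate can be raised independently.\<close>

definition expected_after_shocks :: "real measure \<Rightarrow> (real \<Rightarrow> ennreal) \<Rightarrow> nat \<Rightarrow> ennreal" where
  "expected_after_shocks \<nu> g n = (\<integral>\<^sup>+y. g (\<Sum>i<n. y i) \<partial>PiM {..<n} (\<lambda>_. \<nu>))"

lemma sum_shocks_prob_algebra:
  assumes "prob_space \<nu>" "sets \<nu> = sets nonneg_borel"
  shows "distr (PiM {..<n::nat} (\<lambda>_. \<nu>)) nonneg_borel (\<lambda>y. \<Sum>i<n. y i)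
      \<in> space (prob_algebra nonneg_borel)"
proof -
  have "(\<lambda>y. \<Sum>i<n. y i) \<in> PiM {..<n} (\<lambda>_. \<nu>) \<rightarrow>\<^sub>M nonneg_borel"
    using measurable_sum_nonneg_borel[of n] assms by (simp cong: measurable_cong_sets sets_PiM_cong)
  then show ?thesis
    using assms by (auto simp: space_prob_algebra intro!: prob_space.prob_space_distr prob_space_PiM)
qed

lemma nn_integral_compound_poisson:
  assumes \<nu>: "prob_space \<nu>" "sets \<nu> = sets nonneg_borel" and g: "g \<in> borel_measurable nonneg_borel"
  shows "(\<integral>\<^sup>+d. g d \<partial>compound_poisson l \<nu>) = (\<integral>\<^sup>+n. expected_after_shocks \<nu> g n \<partial>shock_count_pmf l)"
proof -
  have K: "(\<lambda>n. distr (PiM {..<n::nat} (\<lambda>_. \<nu>)) nonneg_borel (\<lambda>y. \<Sum>i<n. y i))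
      \<in> measure_pmf (shock_count_pmf l) \<rightarrow>\<^sub>M subprob_algebra nonneg_borel"
    using sum_shocks_prob_algebra[OF \<nu>]
    by (intro measurable_prob_algebraD) (simp add: measurable_pmf_measure1)
  have "(\<lambda>y. \<Sum>i<n. y i) \<in> PiM {..<n} (\<lambda>_. \<nu>) \<rightarrow>\<^sub>M nonneg_borel" for n :: nat
    using measurable_sum_nonneg_borel[of n] \<nu> by (simp cong: measurable_cong_sets sets_PiM_cong)
  then show ?thesis
    unfolding compound_poisson_def expected_after_shocks_def
    by (simp add: nn_integral_bind[OF g K] nn_integral_distr g)
qed

lemma expected_after_shocks_Suc:
  assumes \<nu>: "prob_space \<nu>" "sets \<nu> = sets nonneg_borel" and g: "g \<in> borel_measurable nonneg_borel"
    and mono: "\<And>x y. 0 \<le> x \<Longrightarrow> x \<le> y \<Longrightarrow> g x \<le> g y"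
  shows "expected_after_shocks \<nu> g n \<le> expected_after_shocks \<nu> g (Suc n)"
proof -
  interpret \<nu>: prob_space \<nu> by fact
  interpret product_sigma_finite "\<lambda>_. \<nu>" by unfold_locales
  have space: "space \<nu> = {0..}" using \<nu>(2)[THEN sets_eq_imp_space_eq] by simp
  have meas: "(\<lambda>y. g (\<Sum>i<n. y i)) \<in> borel_measurable (PiM {..<n} (\<lambda>_. \<nu>))" for n :: nat
    using measurable_compose[OF measurable_sum_nonneg_borel[of n] g] \<nu>
        by (simp cong: measurable_cong_sets sets_PiM_cong)
  \<comment> \<open>A dummy integral over one further shock, of total mass 1, puts both sides on the
    same \<open>n + 1\<close> coordinates; the extra shock is non-negative, so the comparison
    becomes pointwise.\<close>
  have "expected_after_shocks \<nu> g n = (\<integral>\<^sup>+y. \<integral>\<^sup>+z. g (\<Sum>i<n. y i) \<partial>\<nu> \<partial>PiM {..<n} (\<lambda>_. \<nu>))"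
    by (simp add: expected_after_shocks_def \<nu>.emeasure_space_1)
  also have "\<dots> \<le> (\<integral>\<^sup>+y. \<integral>\<^sup>+z. g (\<Sum>i<Suc n. (y(n := z)) i) \<partial>\<nu> \<partial>PiM {..<n} (\<lambda>_. \<nu>))"
    by (intro nn_integral_mono mono) (auto simp: space space_PiM PiE_iff intro!: sum_nonneg)
  also have "\<dots> = expected_after_shocks \<nu> g (Suc n)"
    unfolding expected_after_shocks_def lessThan_Suc
    by (subst product_nn_integral_insert) (use meas[of "Suc n"] in \<open>simp_all add: lessThan_Suc\<close>)
  finally show ?thesis .
qed

lemma nn_integral_mono_st_le:
  assumes \<nu>: "prob_space \<nu>" "sets \<nu> = sets nonneg_borel"
    and \<nu>': "prob_space \<nu>'" "sets \<nu>' = sets nonneg_borel"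
    and le: "st_le \<nu> (\<lambda>y. y) \<nu>' (\<lambda>y. y)"
    and g: "g \<in> borel_measurable nonneg_borel" "\<And>x y. 0 \<le> x \<Longrightarrow> x \<le> y \<Longrightarrow> g x \<le> (g y :: ennreal)"
  shows "(\<integral>\<^sup>+x. g x \<partial>\<nu>) \<le> (\<integral>\<^sup>+x. g x \<partial>\<nu>')"
proof -
  have id: "(\<lambda>y. y) \<in> borel_measurable \<nu>" "(\<lambda>y. y) \<in> borel_measurable \<nu>'"
    using \<nu> \<nu>' by (simp_all cong: measurable_cong_sets add: nonneg_borel_def measurable_restrict_space1)
  \<comment> \<open>\<open>g\<close> is measurable and monotone on the half-line only; composing
    with \<open>max 0\<close> extends it to all reals and changes nothing on the supports.\<close>
  have "(\<lambda>x. max 0 x) \<in> borel \<rightarrow>\<^sub>M nonneg_borel"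
    by (simp add: measurable_nonneg_borel_iff)
  from measurable_compose[OF this g(1)]
  have "(\<integral>\<^sup>+x. g (max 0 x) \<partial>\<nu>) \<le> (\<integral>\<^sup>+x. g (max 0 x) \<partial>\<nu>')"
    by (intro st_le_imp_nn_integral_le \<nu> \<nu>' id le monoI g(2)) auto
  moreover have "space \<nu> = {0..}" "space \<nu>' = {0..}"
    using \<nu>(2)[THEN sets_eq_imp_space_eq] \<nu>'(2)[THEN sets_eq_imp_space_eq] by auto
  ultimately show ?thesis
    by (simp add: max_def cong: nn_integral_cong_simp)
qed

lemma expected_after_shocks_mono:
  assumes \<nu>: "prob_space \<nu>" "sets \<nu> = sets nonneg_borel"
    and \<nu>': "prob_space \<nu>'" "sets \<nu>' = sets nonneg_borel"
    and le: "st_le \<nu> (\<lambda>y. y) \<nu>' (\<lambda>y. y)"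
    and g: "g \<in> borel_measurable nonneg_borel" "\<And>x y. 0 \<le> x \<Longrightarrow> x \<le> y \<Longrightarrow> g x \<le> g y"
  shows "expected_after_shocks \<nu> g n \<le> expected_after_shocks \<nu>' g n"
  unfolding expected_after_shocks_def
proof (rule nn_integral_PiM_mono_coordinates[where S="\<lambda>_. nonneg_borel" and R="\<lambda>_. (\<le>)"])
  show "(\<lambda>y. g (\<Sum>i<n. y i)) \<in> borel_measurable (PiM {..<n} (\<lambda>_. nonneg_borel))"
    using measurable_compose[OF measurable_sum_nonneg_borel g(1)] .
qed (use \<nu> \<nu>' in \<open>auto intro!: g(2) sum_nonneg sum_mono nn_integral_mono_st_le[OF \<nu> \<nu>' le] simp:
    space_PiM PiE_iff\<close>)

text \<open>The shock law is raised first at a fixed count law, then the rate at the larger shock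
  law. The second move works because shocks are non-negative, so the conditional mean increases with
  the number of shocks.\<close>

lemma nn_integral_compound_poisson_mono:
  assumes \<nu>: "prob_space \<nu>" "sets \<nu> = sets nonneg_borel"
    and \<nu>': "prob_space \<nu>'" "sets \<nu>' = sets nonneg_borel"
    and le: "st_le \<nu> (\<lambda>y. y) \<nu>' (\<lambda>y. y)" and l: "0 \<le> l" "l \<le> l'"
    and g: "g \<in> borel_measurable nonneg_borel" "\<And>x y. 0 \<le> x \<Longrightarrow> x \<le> y \<Longrightarrow> g x \<le> g y"
  shows "(\<integral>\<^sup>+d. g d \<partial>compound_poisson l \<nu>) \<le> (\<integral>\<^sup>+d. g d \<partial>compound_poisson l' \<nu>')"
proof -
  have "(\<integral>\<^sup>+d. g d \<partial>compound_poisson l \<nu>) \<le> (\<integral>\<^sup>+n. expected_after_shocks \<nu>' g n \<partial>shock_count_pmf l)"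
    unfolding nn_integral_compound_poisson[OF \<nu> g(1)]
    by (intro nn_integral_mono expected_after_shocks_mono[OF \<nu> \<nu>' le g])
  also have "\<dots> \<le> (\<integral>\<^sup>+n. expected_after_shocks \<nu>' g n \<partial>shock_count_pmf l')"
    by (intro nn_integral_shock_count_mono l mono_iff_le_Suc[THEN iffD2] allI
          expected_after_shocks_Suc[OF \<nu>' g])
  finally show ?thesis
    by (simp only: nn_integral_compound_poisson[OF \<nu>' g(1)])
qed

text \<open>In the rate, the probability of each set of counts is an explicit series of measurable
  terms. In the shock law it suffices to treat each fixed number of shocks, a product kernel
  followed by a push-forward, because the counts form a countable set.\<close>

lemma measurable_compound_poisson:
  assumes l: "l \<in> borel_measurable M" "\<And>x. x \<in> space M \<Longrightarrow> 0 \<le> l x"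
    and K: "K \<in> M \<rightarrow>\<^sub>M prob_algebra nonneg_borel"
  shows "(\<lambda>x. compound_poisson (l x) (K x)) \<in> M \<rightarrow>\<^sub>M prob_algebra nonneg_borel"
  unfolding compound_poisson_def
proof (rule measurable_bind_prob_space2[where N="count_space UNIV"])
  show "(\<lambda>x. measure_pmf (shock_count_pmf (l x))) \<in> M \<rightarrow>\<^sub>M prob_algebra (count_space UNIV)"
  proof (rule measurable_prob_algebraI[OF measure_pmf.prob_space_axioms],
      rule measurable_subprob_algebra)
    fix A :: "nat set"
    have "(\<lambda>x. \<Sum>k. ennreal (l x ^ k / fact k * exp (- l x)) * indicator A k) \<in> borel_measurable M"
      using l(1) by measurable
    moreover have "emeasure (shock_count_pmf (l x)) A
        = (\<Sum>k. ennreal (l x ^ k / fact k * exp (- l x)) * indicator A k)"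
      if "x \<in> space M" for x
      using l(2)[OF that]
      by (simp add: pmf_shock_count nn_integral_measure_pmf nn_integral_count_space_nat
           flip: nn_integral_indicator)
    ultimately show "(\<lambda>x. emeasure (measure_pmf (shock_count_pmf (l x))) A) \<in> borel_measurable M"
      by (simp cong: measurable_cong)
  qed (auto simp: measure_pmf.subprob_space_axioms)
next
  have sum: "(\<lambda>x. distr (PiM {..<n} (\<lambda>_. K x)) nonneg_borel (\<lambda>y. \<Sum>i<n. y i))
      \<in> M \<rightarrow>\<^sub>M prob_algebra nonneg_borel" for n :: nat
    by (rule measurable_compose[OF measurable_PiM_prob_kernel measurable_distr_prob_space])
       (auto intro: K measurable_sum_nonneg_borel)
  show "(\<lambda>(x, n::nat). distr (PiM {..<n} (\<lambda>_. K x)) nonneg_borel (\<lambda>y. \<Sum>i<n. y i))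
      \<in> M \<Otimes>\<^sub>M count_space UNIV \<rightarrow>\<^sub>M prob_algebra nonneg_borel"
    unfolding case_prod_beta'
    by (rule measurable_compose_countable[OF measurable_compose[OF measurable_fst sum] measurable_snd])
qed

section \<open>Transition kernels\<close>

context maintenance_mdp
begin

section \<open>Shock laws and single-machine transitions as kernels\<close>

abbreviation pspace :: "'m \<Rightarrow> real measure" where
  "pspace m \<equiv> restrict_space borel (param_set P m)"

lemma space_pspace: "space (pspace m) = param_set P m"
  by (simp add: space_restrict_space)

lemma sets_ref_measure: "sets (ref_measure P m) = sets nonneg_borel"
  using ref_measure[of m]
proof (elim disjE exE conjE)
  assume "ref_measure P m = restrict_space lborel {0..}"
  then show ?thesis
    by (simp only: nonneg_borel_def) (rule sets_restrict_space_cong, simp)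
next
  fix D assume "ref_measure P m = distr (count_space D) nonneg_borel (\<lambda>y. y)"
  then show ?thesis by (simp only: sets_distr)
qed

lemma sigma_finite_ref_measure: "sigma_finite_measure (ref_measure P m)"
  using ref_measure[of m]
proof (elim disjE exE conjE)
  assume "ref_measure P m = restrict_space lborel {0..}"
  then show ?thesis
    by (simp add: sigma_finite_measure_restrict_space lborel.sigma_finite_measure_axioms)
next
  fix D :: "real set" assume D: "D \<subseteq> {0..}" "countable D"
    and eq: "ref_measure P m = distr (count_space D) nonneg_borel (\<lambda>y. y)"
  have id: "(\<lambda>y. y) \<in> count_space D \<rightarrow>\<^sub>M nonneg_borel" using D by auto
  have sing: "{d} \<in> sets nonneg_borel" if "d \<in> D" for d
    using that D by (auto simp: nonneg_borel_def sets_restrict_space_iff)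
  have D_sets: "D \<in> sets nonneg_borel"
  proof -
    have "D \<in> sets borel" by (rule sets.countable) (use D in auto)
    then show ?thesis using D by (auto simp: nonneg_borel_def sets_restrict_space_iff)
  qed
  show ?thesis
  proof
    \<comment> \<open>In the discrete case the points of \<open>D\<close> have mass 1 each. The
      space is the whole half-line, so the complement of \<open>D\<close> joins the cover as a null
      set.\<close>
    let ?A = "insert ({0..} - D) ((\<lambda>d. {d}) ` D)"
    have "{0..} - D \<in> sets nonneg_borel"
      using sets.compl_sets[OF D_sets] by simp
    moreover have "emeasure (ref_measure P m) ({0..} - D) = 0"
    proof -
      have "({0..} - D) \<inter> D = {}" by auto
      then show ?thesis using calculation by (simp add: eq emeasure_distr[OF id])
    qed
    moreover have "emeasure (ref_measure P m) {d} = 1" if "d \<in> D" for d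
    proof -
      have "(\<lambda>y. y) -` {d} \<inter> D = {d}" using that by auto
      then show ?thesis using that by (simp add: eq emeasure_distr[OF id sing])
    qed
    ultimately show "\<exists>A. countable A \<and> A \<subseteq> sets (ref_measure P m) \<and> \<Union> A = space (ref_measure P m) \<and>
        (\<forall>a\<in>A. emeasure (ref_measure P m) a \<noteq> \<infinity>)"
      using D sing by (intro exI[of _ ?A]) (auto simp: sets_ref_measure eq)
  qed
qed

lemma sets_shock_dist: "sets (shock_dist P m \<phi>) = sets nonneg_borel"
  by (simp add: shock_dist_def sets_ref_measure)

text \<open>\<open>log_partition\<close> is not assumed measurable, but normalisation forces \<open>exp (- A\<^sub>m \<phi>)\<close> to be the
  reciprocal of \<open>\<integral> h\<^sub>m(y) exp (\<phi> y)\<close>, which is.\<close>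

lemma measurable_shock_dist: "shock_dist P m \<in> pspace m \<rightarrow>\<^sub>M prob_algebra nonneg_borel"
proof (rule measurable_prob_algebraI, goal_cases)
  case (1 \<phi>)
  then show ?case by (auto simp: space_pspace prob_space_shock_dist)
next
  case 2
  interpret sigma_finite_measure "ref_measure P m" by (rule sigma_finite_ref_measure)
  \<comment> \<open>\<open>J A \<phi>\<close> is the unnormalised mass of \<open>A\<close>. It does
    not involve the log-partition function, and its integrand is jointly measurable in parameter and
    shock size.\<close>
  define J where "J A \<phi> = (\<integral>\<^sup>+y. ennreal (base_fun P m y * exp (\<phi> * y)) * indicator A y
      \<partial>ref_measure P m)" for A \<phi>
  have space: "space (ref_measure P m) = {0..}"
    using sets_ref_measure[THEN sets_eq_imp_space_eq] by simp
  have base: "base_fun P m \<in> borel_measurable (ref_measure P m)"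
    using base_fun_measurable[of m] sets_ref_measure by (simp cong: measurable_cong_sets)
  have id: "(\<lambda>y. y) \<in> borel_measurable (ref_measure P m)"
    by (simp cong: measurable_cong_sets add: sets_ref_measure nonneg_borel_def
        measurable_restrict_space1)
  have idp: "(\<lambda>y. y) \<in> borel_measurable (pspace m)"
    by (simp add: measurable_restrict_space1)
  have J_meas: "J A \<in> borel_measurable (pspace m)" if A: "A \<in> sets nonneg_borel" for A
    unfolding J_def
  proof (rule borel_measurable_nn_integral)
    have "A \<in> sets (ref_measure P m)" using A by (simp add: sets_ref_measure)
    then show "(\<lambda>(\<phi>, y). ennreal (base_fun P m y * exp (\<phi> * y)) * indicator A y)
        \<in> borel_measurable (pspace m \<Otimes>\<^sub>M ref_measure P m)"
      using measurable_compose[OF measurable_snd base] measurable_compose[OF measurable_snd id]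
        measurable_compose[OF measurable_fst idp]
      unfolding case_prod_beta' by measurable
  qed
  have shock: "emeasure (shock_dist P m \<phi>) A = ennreal (exp (- log_partition P m \<phi>)) * J A \<phi>" if A: "A
      \<in> sets nonneg_borel" for A \<phi>
  proof -
    have "emeasure (shock_dist P m \<phi>) A = (\<integral>\<^sup>+y. ennreal (shock_density P m \<phi> y) * indicator A y
        \<partial>ref_measure P m)"
      unfolding shock_dist_def shock_density_def using base id A
      by (intro emeasure_density) (auto simp: sets_ref_measure)
    also have "\<dots> = (\<integral>\<^sup>+y. ennreal (exp (- log_partition P m \<phi>)) * (ennreal (base_fun P m y * exp
        (\<phi> * y)) * indicator A y) \<partial>ref_measure P m)"
    proof (rule nn_integral_cong)
      fix y
      have "shock_density P m \<phi> y = exp (- log_partition P m \<phi>) * (base_fun P m y * exp (\<phi> * y))"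
        by (simp add: shock_density_def exp_diff exp_minus field_simps)
      then show "ennreal (shock_density P m \<phi> y) * indicator A y =
          ennreal (exp (- log_partition P m \<phi>)) * (ennreal (base_fun P m y * exp
              (\<phi> * y)) * indicator A y)"
        by (simp add: ennreal_mult' mult.assoc)
    qed
    also have "\<dots> = ennreal (exp (- log_partition P m \<phi>)) * J A \<phi>"
    proof -
      have "A \<in> sets (ref_measure P m)" using A by (simp add: sets_ref_measure)
      then have "(\<lambda>y. ennreal (base_fun P m y * exp (\<phi> * y)) * indicator A y)
          \<in> borel_measurable (ref_measure P m)"
        using base id by measurable
      then show ?thesis unfolding J_def by (rule nn_integral_cmult)
    qed
    finally show ?thesis .
  qed
  have norm: "ennreal (exp (- log_partition P m \<phi>)) = inverse (J {0..} \<phi>)" if \<phi>: "\<phi>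
      \<in> param_set P m" for \<phi>
  proof -
    have "space (shock_dist P m \<phi>) = {0..}"
      using sets_shock_dist[THEN sets_eq_imp_space_eq] by simp
    then have "ennreal (exp (- log_partition P m \<phi>)) * J {0..} \<phi> = 1"
      using prob_space.emeasure_space_1[OF prob_space_shock_dist[OF \<phi>]] shock[of "{0..}" \<phi>] sets.top[of
          nonneg_borel]
      by simp
    \<comment> \<open>A product equal to 1 in \<open>ennreal\<close> excludes both 0 and infinity,
      so the total mass may be cancelled.\<close>
    moreover have "J {0..} \<phi> \<noteq> \<infinity>" "J {0..} \<phi> \<noteq> 0"
      using calculation by (auto simp: ennreal_mult_eq_top_iff ennreal_mult_top)
    ultimately show ?thesis
      using ennreal_mult_divide_eq[of "J {0..} \<phi>" "ennreal (exp (- log_partition P m \<phi>))"]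
      by (simp add: divide_ennreal_def)
  qed
  show ?case
  proof (rule measurable_subprob_algebra)
    fix A assume A: "A \<in> sets nonneg_borel"
    have "(\<lambda>\<phi>. inverse (J {0..} \<phi>) * J A \<phi>) \<in> borel_measurable (pspace m)"
      using J_meas[OF A] J_meas[of "{0..}"] sets.top[of nonneg_borel] by simp
    moreover have "emeasure (shock_dist P m \<phi>) A = inverse (J {0..} \<phi>) * J A \<phi>" if "\<phi>
        \<in> space (pspace m)" for \<phi>
      using that by (simp add: shock[OF A] norm space_pspace)
    ultimately show "(\<lambda>\<phi>. emeasure (shock_dist P m \<phi>) A) \<in> borel_measurable (pspace m)"
      by (simp cong: measurable_cong)
  qed (auto simp: space_pspace sets_shock_dist intro!: prob_space_imp_subprob_space
      prob_space_shock_dist)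
qed

lemma space_machine_space: "space (machine_space P m) = {0..} \<times> {0..} \<times> param_set P m"
  by (simp add: machine_space_def space_pair_measure space_pspace)

lemma compound_poisson_kernel:
  "(\<lambda>s. compound_poisson (fst (snd s)) (shock_dist P m (snd (snd s))))
      \<in> machine_space P m \<rightarrow>\<^sub>M prob_algebra nonneg_borel"
proof (rule measurable_compound_poisson)
  have snd: "snd \<in> machine_space P m \<rightarrow>\<^sub>M nonneg_borel \<Otimes>\<^sub>M pspace m"
    by (simp add: machine_space_def)
  show "(\<lambda>s. fst (snd s)) \<in> borel_measurable (machine_space P m)"
    by (rule measurable_from_nonneg_borel[OF measurable_compose[OF snd measurable_fst]])
  show "(\<lambda>s. shock_dist P m (snd (snd s))) \<in> machine_space P m \<rightarrow>\<^sub>M prob_algebra nonneg_borel"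
    by (rule measurable_compose[OF measurable_compose[OF snd measurable_snd] measurable_shock_dist])
qed (auto simp: space_machine_space)

lemma measurable_add_damage:
  "(\<lambda>(s, d). (fst s + d, snd s)) \<in> machine_space P m \<Otimes>\<^sub>M nonneg_borel \<rightarrow>\<^sub>M machine_space P m"
proof -
  have "(\<lambda>z. fst (fst z) + snd z) \<in> machine_space P m \<Otimes>\<^sub>M nonneg_borel \<rightarrow>\<^sub>M nonneg_borel"
  proof -
    have "(\<lambda>z. fst (fst z)) \<in> machine_space P m \<Otimes>\<^sub>M nonneg_borel \<rightarrow>\<^sub>M nonneg_borel"
      by (simp add: machine_space_def)
    then have "(\<lambda>z. fst (fst z)) \<in> borel_measurable (machine_space P m \<Otimes>\<^sub>M nonneg_borel)"
      by (rule measurable_from_nonneg_borel)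
    then show ?thesis
      unfolding measurable_nonneg_borel_iff
      by (auto simp: space_pair_measure space_machine_space
            intro!: borel_measurable_add measurable_from_nonneg_borel[OF measurable_snd])
  qed
  moreover have "(\<lambda>z. snd (fst z)) \<in> machine_space P m \<Otimes>\<^sub>M nonneg_borel \<rightarrow>\<^sub>M nonneg_borel \<Otimes>\<^sub>M pspace m"
    by (simp add: machine_space_def)
  ultimately show ?thesis
    unfolding case_prod_beta' machine_space_def[of P m, THEN arg_cong2[where f=measurable, OF refl]]
    by (rule measurable_Pair)
qed

lemma degrade_alt:
  "degrade P m s = distr (compound_poisson (fst (snd s)) (shock_dist P m (snd (snd s))))
      (machine_space P m) (\<lambda>d. (fst s + d, snd s))"
  by (simp add: degrade_def case_prod_beta')

lemma degrade_kernel: "degrade P m \<in> machine_space P m \<rightarrow>\<^sub>M prob_algebra (machine_space P m)"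
  unfolding degrade_alt[abs_def]
  by (rule measurable_distr_prob_space2[OF compound_poisson_kernel measurable_add_damage])

lemma reset_pair_measurable:
  "(\<lambda>(l, \<phi>). (0, l, \<phi>)) \<in> rate_dist P m \<Otimes>\<^sub>M param_dist P m \<rightarrow>\<^sub>M machine_space P m"
proof -
  have "(\<lambda>z. (0, z)) \<in> rate_dist P m \<Otimes>\<^sub>M param_dist P m \<rightarrow>\<^sub>M nonneg_borel \<Otimes>\<^sub>M (nonneg_borel \<Otimes>\<^sub>M pspace m)"
    using sets_rate_dist[of m] sets_param_dist[of m]
    by (intro measurable_Pair) (auto cong: measurable_cong_sets sets_pair_measure_cong)
  then show ?thesis by (simp add: machine_space_def case_prod_beta')
qed

lemma reset_kernel: "(\<lambda>s. reset_dist P m s b) \<in> machine_space P m \<rightarrow>\<^sub>M prob_algebra (machine_space P m)"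
proof (cases b)
  case True
  have "distr (rate_dist P m \<Otimes>\<^sub>M param_dist P m) (machine_space P m) (\<lambda>(l, \<phi>). (0, l, \<phi>))
      \<in> space (prob_algebra (machine_space P m))"
    unfolding space_prob_algebra
    using prob_space.prob_space_distr[OF prob_space_pair[OF prob_space_rate_dist prob_space_param_dist]
        reset_pair_measurable]
    by simp
  then show ?thesis using True by (simp add: reset_dist_def)
qed (simp add: reset_dist_def)

text \<open>The coordinate law of \<open>next_state\<close>, named so that the product lemmas can be
  applied to the whole transition.\<close>

definition machine_step :: "'m \<Rightarrow> machine_state \<Rightarrow> bool \<Rightarrow> machine_state measure" where
  "machine_step m s b = reset_dist P m s b \<bind> degrade P m"

lemma machine_step_kernel: "(\<lambda>s. machine_step m s b)
    \<in> machine_space P m \<rightarrow>\<^sub>M prob_algebra (machine_space P m)"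
  unfolding machine_step_def by (rule measurable_bind_prob_space[OF reset_kernel degrade_kernel])

lemma next_state_alt: "next_state P h a = PiM UNIV (\<lambda>m. machine_step m (h m) (a m))"
  by (simp add: next_state_def machine_step_def)

lemma next_state_kernel: "(\<lambda>h. next_state P h a) \<in> state_space P \<rightarrow>\<^sub>M prob_algebra (state_space P)"
  unfolding next_state_alt state_space_def
  by (rule measurable_PiM_prob_kernel[OF finite], rule measurable_compose[OF _ machine_step_kernel],
      rule measurable_component_singleton) simp

lemma space_state_space: "space (state_space P) = {h. \<forall>m. h m \<in> space (machine_space P m)}"
  by (auto simp: state_space_def space_PiM)

section \<open>Monotone dependence of transitions on the state\<close>

text \<open>Only the shock-size laws are compared, not the parameters: the monotonicity of the shock sizes
  is available for the given pair of parameters only.\<close>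

definition machine_le :: "'m \<Rightarrow> machine_state \<Rightarrow> machine_state \<Rightarrow> bool" where
  "machine_le m s s' \<longleftrightarrow> fst s \<le> fst s' \<and> fst (snd s) \<le> fst (snd s') \<and>
     st_le (shock_dist P m (snd (snd s))) (\<lambda>y. y) (shock_dist P m (snd (snd s'))) (\<lambda>y. y)"

definition state_le :: "'m state \<Rightarrow> 'm state \<Rightarrow> bool" where
  "state_le h h' \<longleftrightarrow> (\<forall>m. machine_le m (h m) (h' m))"

lemma machine_le_refl: "machine_le m s s"
  by (simp add: machine_le_def st_le_def)

lemma nn_integral_degrade:
  assumes s: "s \<in> space (machine_space P m)" and g: "g \<in> borel_measurable (machine_space P m)"
  shows "(\<integral>\<^sup>+z. g z \<partial>degrade P m s) = (\<integral>\<^sup>+d. g (fst s + d, snd s)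
      \<partial>compound_poisson (fst (snd s)) (shock_dist P m (snd (snd s))))"
    and "(\<lambda>d. g (fst s + d, snd s)) \<in> borel_measurable nonneg_borel"
proof -
  have 1: "(\<lambda>d. (fst s + d, snd s)) \<in> nonneg_borel \<rightarrow>\<^sub>M machine_space P m"
    using measurable_compose[OF measurable_Pair1'[OF s] measurable_add_damage] by simp
  then show "(\<lambda>d. g (fst s + d, snd s)) \<in> borel_measurable nonneg_borel"
    using measurable_compose[OF 1 g] by simp
  have "sets (compound_poisson (fst (snd s)) (shock_dist P m (snd (snd s)))) = sets nonneg_borel"
    using measurable_space[OF compound_poisson_kernel s] by (simp add: space_prob_algebra)
  then have "(\<lambda>d. (fst s + d, snd s)) \<in> compound_poisson (fst (snd s)) (shock_dist P m (snd (snd s)))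
      \<rightarrow>\<^sub>M machine_space P m"
    using 1 by (simp cong: measurable_cong_sets)
  then show "(\<integral>\<^sup>+z. g z \<partial>degrade P m s) = (\<integral>\<^sup>+d. g (fst s + d, snd s)
      \<partial>compound_poisson (fst (snd s)) (shock_dist P m (snd (snd s))))"
    unfolding degrade_alt using g by (simp add: nn_integral_distr)
qed

text \<open>A replaced machine forgets its state. For a kept machine, the damage law is raised while
  the starting triple stays \<open>s\<close>, so \<open>g\<close> is compared only between levels
  with equal parameters; then \<open>s\<close> is replaced by \<open>s'\<close> pointwise, at equal
  damage. Changing both at once would require a coupling of the two damages.\<close>

lemma nn_integral_machine_step_mono:
  assumes s: "s \<in> space (machine_space P m)" "s' \<in> space (machine_space P m)" "machine_le m s s'"
    and g: "g \<in> borel_measurable (machine_space P m)"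
    and mono: "\<And>x y. x \<in> space (machine_space P m) \<Longrightarrow> y
        \<in> space (machine_space P m) \<Longrightarrow> machine_le m x y \<Longrightarrow> g x \<le> (g y :: ennreal)"
  shows "(\<integral>\<^sup>+z. g z \<partial>machine_step m s b) \<le> (\<integral>\<^sup>+z. g z \<partial>machine_step m s' b)"
proof (cases b)
  case True
  then show ?thesis by (simp add: machine_step_def reset_dist_def)
next
  case False
  let ?\<nu> = "shock_dist P m (snd (snd s))" and ?\<nu>' = "shock_dist P m (snd (snd s'))"
  have \<nu>: "prob_space ?\<nu>" "sets ?\<nu> = sets nonneg_borel" "prob_space ?\<nu>'" "sets ?\<nu>' = sets nonneg_borel"
    using s by (auto simp: space_machine_space sets_shock_dist prob_space_shock_dist)
  have le: "st_le ?\<nu> (\<lambda>y. y) ?\<nu>' (\<lambda>y. y)" "fst (snd s) \<le> fst (snd s')" "fst s \<le> fst s'"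
    using s by (auto simp: machine_le_def)
  have pos: "0 \<le> fst s" "0 \<le> fst s'" "0 \<le> fst (snd s)" "0 \<le> fst (snd s')"
    "snd s \<in> {0..} \<times> param_set P m" "snd s' \<in> {0..} \<times> param_set P m"
    using s by (auto simp: space_machine_space)
  have step: "machine_step m r b = degrade P m r" if "r \<in> space (machine_space P m)" for r
    using that False by (simp add: machine_step_def reset_dist_def bind_return[OF
        measurable_prob_algebraD[OF degrade_kernel]])
  have "(\<integral>\<^sup>+z. g z \<partial>machine_step m s b) = (\<integral>\<^sup>+d. g (fst s + d, snd s)
      \<partial>compound_poisson (fst (snd s)) ?\<nu>)"
    using s g by (simp add: step nn_integral_degrade)
  also have "\<dots> \<le> (\<integral>\<^sup>+d. g (fst s + d, snd s) \<partial>compound_poisson (fst (snd s')) ?\<nu>')"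
  proof (rule nn_integral_compound_poisson_mono[OF \<nu> le(1) pos(3) le(2) nn_integral_degrade(2)[OF s(1)
      g]])
    fix x y :: real assume "0 \<le> x" "x \<le> y"
    then show "g (fst s + x, snd s) \<le> g (fst s + y, snd s)"
      using pos by (intro mono) (auto simp: space_machine_space machine_le_def st_le_def)
  qed
  also have "\<dots> \<le> (\<integral>\<^sup>+d. g (fst s' + d, snd s') \<partial>compound_poisson (fst (snd s')) ?\<nu>')"
  proof (rule nn_integral_mono)
    fix d assume "d \<in> space (compound_poisson (fst (snd s')) ?\<nu>')"
    then have "0 \<le> d"
      using measurable_space[OF compound_poisson_kernel s(2)]
          by (auto simp: space_prob_algebra dest!: sets_eq_imp_space_eq)
    then show "g (fst s + d, snd s) \<le> g (fst s' + d, snd s')"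
      using pos le by (intro mono) (auto simp: space_machine_space machine_le_def)
  qed
  also have "\<dots> = (\<integral>\<^sup>+z. g z \<partial>machine_step m s' b)"
    using s g by (simp add: step nn_integral_degrade)
  finally show ?thesis .
qed

lemma nn_integral_next_state_mono:
  assumes h: "h \<in> space (state_space P)" "h' \<in> space (state_space P)" "state_le h h'"
    and f: "f \<in> borel_measurable (state_space P)"
    and mono: "\<And>x y. x \<in> space (state_space P) \<Longrightarrow> y
        \<in> space (state_space P) \<Longrightarrow> state_le x y \<Longrightarrow> f x \<le> (f y :: ennreal)"
  shows "(\<integral>\<^sup>+z. f z \<partial>next_state P h a) \<le> (\<integral>\<^sup>+z. f z \<partial>next_state P h' a)"
  unfolding next_state_alt
proof (rule nn_integral_PiM_mono_coordinates[where S="machine_space P" and R="machine_le"])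
  have "machine_step m (k m) (a m) \<in> space (prob_algebra (machine_space P m))" if "k
      \<in> space (state_space P)" for k m
    using that by (intro measurable_space[OF machine_step_kernel]) (auto simp: space_state_space)
  then show "prob_space (machine_step m (h m) (a m))" "sets (machine_step m (h m) (a m))
      = sets (machine_space P m)"
    "prob_space (machine_step m (h' m) (a m))" "sets (machine_step m (h' m) (a m))
        = sets (machine_space P m)" for m
    using h by (auto simp: space_prob_algebra)
qed (use h f in \<open>auto intro!: mono nn_integral_machine_step_mono machine_le_refl
        simp: space_state_space state_le_def simp flip: state_space_def\<close>)

end

section \<open>Dynamic programming\<close>

lemma measurable_measure_pmf_finite:
  fixes p :: "'b \<Rightarrow> 'a::finite pmf"
  assumes "\<And>a. (\<lambda>x. pmf (p x) a) \<in> borel_measurable M"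
  shows "(\<lambda>x. measure_pmf (p x)) \<in> M \<rightarrow>\<^sub>M prob_algebra (count_space UNIV)"
proof (rule measurable_prob_algebraI[OF measure_pmf.prob_space_axioms], rule measurable_subprob_algebra)
  fix A :: "'a set"
  have "(\<lambda>x. ennreal (\<Sum>a\<in>A. pmf (p x) a)) \<in> borel_measurable M"
    using assms by measurable
  then show "(\<lambda>x. emeasure (measure_pmf (p x)) A) \<in> borel_measurable M"
    by (simp add: measure_pmf.emeasure_eq_measure measure_measure_pmf_finite)
qed (auto simp: measure_pmf.subprob_space_axioms)

text \<open>A minimiser exists because there are finitely many actions; the point is to break ties
  measurably. Actions are numbered by an injection into the naturals and the best one with the least
  number is taken.\<close>

lemma measurable_finite_minimizer:
  fixes f :: "'b \<Rightarrow> 'a::finite \<Rightarrow> ennreal"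
  assumes f: "\<And>a. (\<lambda>x. f x a) \<in> borel_measurable M"
    and A: "\<And>a. Measurable.pred M (\<lambda>x. a \<in> A x)" "\<And>x. x \<in> space M \<Longrightarrow> A x \<noteq> {}"
  shows "\<exists>g \<in> M \<rightarrow>\<^sub>M count_space UNIV. \<forall>x\<in>space M. g x \<in> A x \<and> (\<forall>b\<in>A x. f x (g x) \<le> f x b)"
proof -
  obtain code :: "'a \<Rightarrow> nat" where code: "inj code"
    using finite_imp_inj_to_nat_seg[of "UNIV :: 'a set"] by auto
  define best where "best x a \<longleftrightarrow> a \<in> A x \<and> (\<forall>b. b \<in> A x \<longrightarrow> f x a \<le> f x b)" for x a
  define g where "g x = inv code (LEAST i. \<exists>a. i = code a \<and> best x a)" for x
  have [measurable]: "Measurable.pred M (\<lambda>x. best x a)" for a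
    unfolding best_def using f A(1) by measurable
  have "g \<in> M \<rightarrow>\<^sub>M count_space UNIV"
    unfolding g_def by measurable
  moreover have "best x (g x)" if x: "x \<in> space M" for x
  proof -
    have "finite (f x ` A x)" "f x ` A x \<noteq> {}" using A(2)[OF x] by auto
    from Min_in[OF this] obtain a where "a \<in> A x" "f x a = Min (f x ` A x)" by auto
    then have "best x a" by (auto simp: best_def)
    then have "\<exists>a. (LEAST i. \<exists>a. i = code a \<and> best x a) = code a \<and> best x a"
      by (intro LeastI[of "\<lambda>i. \<exists>a. i = code a \<and> best x a"]) auto
    then show ?thesis using code by (auto simp: g_def)
  qed
  ultimately show ?thesis by (intro bexI[of _ g]) (auto simp: best_def)
qed

context maintenance_mdp
begin

lemma UNIV_in_actions: "(\<lambda>_. True) \<in> actions P h"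
  by (simp add: actions_def)

lemma cost_nonneg: "0 \<le> cost P h a"
  unfolding cost_def using setup_cost_nonneg pm_cost_pos pm_less_cm
  by (intro add_nonneg_nonneg sum_nonneg mult_nonneg_nonneg) (auto intro: less_imp_le less_trans)

text \<open>The stage cost if every machine needed corrective replacement. Its geometric series
  bounds all values, so that passing from \<open>ennreal\<close> back to the reals loses
  nothing.\<close>

definition cost_bound :: real where
  "cost_bound = setup_cost P + (\<Sum>m\<in>UNIV. cm_cost P m)"

lemma cost_le_bound: "cost P h a \<le> cost_bound"
proof -
  have "cm_cost P m * of_bool (a m \<and> threshold P m
      \<le> level h m) + pm_cost P m * of_bool (a m \<and> level h m < threshold P m)
      \<le> cm_cost P m" for m
    using pm_cost_pos[of m] pm_less_cm[of m] by auto
  then show ?thesis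
    unfolding cost_def cost_bound_def using setup_cost_nonneg by (intro add_mono sum_mono) auto
qed

text \<open>At a fixed action, a higher level can only turn a preventive replacement into a dearer
  corrective one; setup and machines that are not maintained cost the same in both states.\<close>

lemma cost_mono: "state_le h h' \<Longrightarrow> cost P h a \<le> cost P h' a"
  unfolding cost_def
proof (intro add_left_mono sum_mono)
  fix m assume "state_le h h'"
  then have "level h m \<le> level h' m" by (simp add: state_le_def machine_le_def)
  then show "cm_cost P m * of_bool (a m \<and> threshold P m
      \<le> level h m) + pm_cost P m * of_bool (a m \<and> level h m < threshold P m)
      \<le> cm_cost P m * of_bool (a m \<and> threshold P m
          \<le> level h' m) + pm_cost P m * of_bool (a m \<and> level h' m < threshold P m)"
    using pm_cost_pos[of m] pm_less_cm[of m] by auto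
qed

lemma actions_antimono: "state_le h h' \<Longrightarrow> actions P h' \<subseteq> actions P h"
  by (auto simp: actions_def state_le_def machine_le_def intro: order_trans)

lemma measurable_level: "(\<lambda>h. level h m) \<in> borel_measurable (state_space P)"
proof (rule measurable_from_nonneg_borel)
  have "(\<lambda>h. h m) \<in> state_space P \<rightarrow>\<^sub>M machine_space P m"
    by (simp add: state_space_def)
  then show "(\<lambda>h. level h m) \<in> state_space P \<rightarrow>\<^sub>M nonneg_borel"
    by (rule measurable_compose) (simp add: machine_space_def)
qed

lemma measurable_cost: "(\<lambda>h. cost P h a) \<in> borel_measurable (state_space P)"
  unfolding cost_def of_bool_def using measurable_level by measurable

lemma measurable_actions: "Measurable.pred (state_space P) (\<lambda>h. a \<in> actions P h)"
  unfolding actions_def using measurable_level by measurable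

section \<open>The Bellman operator and value iteration\<close>

text \<open>One-step lookahead with an arbitrary continuation \<open>f\<close>. The recursion can
  thus be developed before anything is known about \<open>V\<close>.\<close>

definition qval :: "('m state \<Rightarrow> ennreal) \<Rightarrow> 'm state \<Rightarrow> 'm action \<Rightarrow> ennreal" where
  "qval f h a = ennreal (cost P h a) + ennreal (discount P) * (\<integral>\<^sup>+h'. f h' \<partial>next_state P h a)"

definition bellman :: "('m state \<Rightarrow> ennreal) \<Rightarrow> 'm state \<Rightarrow> ennreal" where
  "bellman f h = (INF a\<in>actions P h. qval f h a)"

lemma measurable_nn_integral_next_state:
  "f \<in> borel_measurable (state_space P) \<Longrightarrow> (\<lambda>h. \<integral>\<^sup>+h'. f h' \<partial>next_state P h a)
      \<in> borel_measurable (state_space P)"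
  by (rule measurable_compose[OF measurable_prob_algebraD[OF next_state_kernel]
      nn_integral_measurable_subprob_algebra])

lemma measurable_qval:
  "f \<in> borel_measurable (state_space P) \<Longrightarrow> (\<lambda>h. qval f h a) \<in> borel_measurable (state_space P)"
  unfolding qval_def using measurable_nn_integral_next_state[of f a] measurable_cost by measurable

lemma bellman_le: "a \<in> actions P h \<Longrightarrow> bellman f h \<le> qval f h a"
  unfolding bellman_def by (rule INF_lower)

lemma measurable_bellman:
  assumes f: "f \<in> borel_measurable (state_space P)"
  shows "bellman f \<in> borel_measurable (state_space P)"
proof -
  \<comment> \<open>Giving inadmissible actions the value \<open>\<top>\<close> makes the index set
    independent of the state, so measurability reduces to an infimum of finitely many measurable
    functions.\<close>
  have eq: "bellman f = (\<lambda>h. INF a. if a \<in> actions P h then qval f h a else \<top>)"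
    unfolding bellman_def
  proof (intro ext antisym)
    fix h
    show "(INF a\<in>actions P h. qval f h a) \<le> (INF a. if a \<in> actions P h then qval f h a else \<top>)"
      by (rule INF_greatest) (simp add: INF_lower)
    show "(INF a. if a \<in> actions P h then qval f h a else \<top>) \<le> (INF a\<in>actions P h. qval f h a)"
    proof (rule INF_greatest)
      fix a assume "a \<in> actions P h"
      then show "(INF a. if a \<in> actions P h then qval f h a else \<top>) \<le> qval f h a"
        by (intro INF_lower2[of a]) auto
    qed
  qed
  show ?thesis
    unfolding eq using measurable_qval[OF f] measurable_actions by measurable
qed

lemma qval_mono:
  assumes "h \<in> space (state_space P)" "\<And>h. h \<in> space (state_space P) \<Longrightarrow> f h \<le> g h"
  shows "qval f h a \<le> qval g h a"
proof -
  have "space (next_state P h a) = space (state_space P)"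
    using measurable_space[OF next_state_kernel assms(1)]
        by (auto simp: space_prob_algebra dest: sets_eq_imp_space_eq)
  then show ?thesis
    unfolding qval_def by (intro add_left_mono mult_left_mono nn_integral_mono assms(2)) auto
qed

lemma bellman_mono:
  assumes "h \<in> space (state_space P)" "\<And>h. h \<in> space (state_space P) \<Longrightarrow> f h \<le> g h"
  shows "bellman f h \<le> bellman g h"
  unfolding bellman_def by (intro INF_mono) (meson qval_mono assms)

lemma bellman_state_mono:
  assumes h: "h \<in> space (state_space P)" "h' \<in> space (state_space P)" "state_le h h'"
    and f: "f \<in> borel_measurable (state_space P)"
    and mono: "\<And>x y. x \<in> space (state_space P) \<Longrightarrow> y \<in> space (state_space P) \<Longrightarrow> state_le x y \<Longrightarrow> f x \<le> f y"
  shows "bellman f h \<le> bellman f h'"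
proof -
  have "qval f h a \<le> qval f h' a" for a
    unfolding qval_def using cost_mono[OF h(3)] nn_integral_next_state_mono[OF h f mono]
    by (intro add_mono mult_left_mono ennreal_leI) auto
  then show ?thesis
    unfolding bellman_def using actions_antimono[OF h(3)] by (intro INF_mono) blast
qed

text \<open>The optimal cost over \<open>n\<close> epochs with terminal value 0, obtained by
  backward induction.\<close>

definition val_iter :: "nat \<Rightarrow> 'm state \<Rightarrow> ennreal" where
  "val_iter n = (bellman ^^ n) (\<lambda>_. 0)"

lemma val_iter_0: "val_iter 0 = (\<lambda>_. 0)" and val_iter_Suc: "val_iter (Suc n) = bellman (val_iter n)"
  by (simp_all add: val_iter_def)

lemma measurable_val_iter: "val_iter n \<in> borel_measurable (state_space P)"
  by (induction n) (simp_all add: val_iter_0 val_iter_Suc measurable_bellman)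

lemma val_iter_state_mono:
  "h \<in> space (state_space P) \<Longrightarrow> h' \<in> space (state_space P) \<Longrightarrow> state_le h h' \<Longrightarrow> val_iter n h \<le> val_iter n h'"
  by (induction n arbitrary: h h')
     (auto simp: val_iter_0 val_iter_Suc intro!: bellman_state_mono measurable_val_iter)

lemma val_iter_mono: "h \<in> space (state_space P) \<Longrightarrow> val_iter n h \<le> val_iter (Suc n) h"
  by (induction n arbitrary: h) (auto simp: val_iter_0 val_iter_Suc intro!: bellman_mono)

lemma incseq_val_iter: "h \<in> space (state_space P) \<Longrightarrow> incseq (\<lambda>n. val_iter n h)"
  by (intro incseq_SucI val_iter_mono)

definition opt_val :: "'m state \<Rightarrow> ennreal" where
  "opt_val h = (SUP n. val_iter n h)"

lemma measurable_opt_val: "opt_val \<in> borel_measurable (state_space P)"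
  unfolding opt_val_def[abs_def] using measurable_val_iter by measurable

lemma opt_val_state_mono:
  "h \<in> space (state_space P) \<Longrightarrow> h' \<in> space (state_space P) \<Longrightarrow> state_le h h' \<Longrightarrow> opt_val h \<le> opt_val h'"
  unfolding opt_val_def by (intro SUP_mono) (use val_iter_state_mono in blast)

lemma qval_opt_val:
  assumes h: "h \<in> space (state_space P)"
  shows "qval opt_val h a = (SUP n. qval (val_iter n) h a)"
proof -
  have sets: "sets (next_state P h a) = sets (state_space P)"
    using measurable_space[OF next_state_kernel h] by (auto simp: space_prob_algebra)
  have "(\<integral>\<^sup>+h'. opt_val h' \<partial>next_state P h a) = (SUP n. \<integral>\<^sup>+h'. val_iter n h' \<partial>next_state P h a)"
    unfolding opt_val_def
  proof (rule nn_integral_monotone_convergence_SUP_AE)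
    \<comment> \<open>The iterates are known to increase only on the state space, which carries the
      transition law; hence the almost-everywhere form of monotone convergence.\<close>
    show "AE x in next_state P h a. val_iter i x \<le> val_iter (Suc i) x" for i
      using sets[THEN sets_eq_imp_space_eq] by (auto intro: val_iter_mono)
    show "val_iter i \<in> borel_measurable (next_state P h a)" for i
      using sets measurable_val_iter by (simp cong: measurable_cong_sets)
  qed
  then show ?thesis
    by (simp add: qval_def SUP_mult_left_ennreal ennreal_SUP_add_right)
qed

text \<open>A minimum over finitely many actions commutes with an increasing supremum. This
  inequality is what makes a greedy action for \<open>opt_val\<close> affordable; the lower bound on
  policies works with the iterates themselves.\<close>

lemma bellman_opt_val_le:
  assumes h: "h \<in> space (state_space P)"
  shows "bellman opt_val h \<le> opt_val h"
proof (rule ccontr)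
  assume "\<not> bellman opt_val h \<le> opt_val h"
  then have "opt_val h < (SUP n. qval (val_iter n) h a)" if "a \<in> actions P h" for a
    using bellman_le[OF that, of opt_val] by (simp add: qval_opt_val[OF h] not_le)
  then have "\<forall>a\<in>actions P h. \<exists>n. opt_val h < qval (val_iter n) h a"
    by (auto simp: less_SUP_iff)
  then obtain n where n: "\<And>a. a \<in> actions P h \<Longrightarrow> opt_val h < qval (val_iter (n a)) h a"
    by metis
  \<comment> \<open>If every action exceeded \<open>opt_val h\<close> in the limit, each would do so
    at some index; one common index for all of them already makes the next iterate too
    large.\<close>
  define N where "N = Max (n ` actions P h)"
  have fin: "finite (actions P h)" by simp
  have "opt_val h < qval (val_iter N) h a" if a: "a \<in> actions P h" for a
  proof -
    have "n a \<le> N" using a fin by (simp add: N_def)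
    then have "qval (val_iter (n a)) h a \<le> qval (val_iter N) h a"
      by (intro qval_mono h incseqD[OF incseq_val_iter])
    then show ?thesis using n[OF a] by simp
  qed
  moreover obtain a where "a \<in> actions P h" "bellman (val_iter N) h = qval (val_iter N) h a"
  proof -
    have "finite (qval (val_iter N) h ` actions P h)" "qval (val_iter N) h ` actions P h \<noteq> {}"
      using fin UNIV_in_actions[of h] by auto
    then have "bellman (val_iter N) h \<in> qval (val_iter N) h ` actions P h"
      unfolding bellman_def by (metis Min_in Min_Inf)
    then show ?thesis using that by blast
  qed
  ultimately have "opt_val h < val_iter (Suc N) h" by (simp add: val_iter_Suc)
  also have "\<dots> \<le> opt_val h" unfolding opt_val_def by (rule SUP_upper) simp
  finally show False by simp
qed

section \<open>Trajectories\<close>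

text \<open>The part of \<open>step_kernel\<close> that precedes the draw of the action. Once it is
  split off, the choice made by the policy can be studied conditionally on history and
  state.\<close>

definition state_law :: "'m state \<Rightarrow> nat \<Rightarrow> (nat \<Rightarrow> 'm state \<times> 'm action) \<Rightarrow> 'm state measure" where
  "state_law h\<^sub>0 t w =
     (case t of 0 \<Rightarrow> return (state_space P) h\<^sub>0 | Suc s \<Rightarrow> next_state P (fst (w s)) (snd (w s)))"

lemma measurable_next_state_pair:
  "(\<lambda>z. next_state P (fst z) (snd z)) \<in> step_space P \<rightarrow>\<^sub>M prob_algebra (state_space P)"
  unfolding step_space_def
  by (rule measurable_compose_countable[OF measurable_compose[OF measurable_fst next_state_kernel]
      measurable_snd])

lemma measurable_cost_pair: "(\<lambda>z. cost P (fst z) (snd z)) \<in> borel_measurable (step_space P)"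
  unfolding step_space_def
  by (rule measurable_compose_countable[OF measurable_compose[OF measurable_fst measurable_cost]
      measurable_snd])

lemma measurable_qval_pair:
  assumes f: "f \<in> borel_measurable (state_space P)"
  shows "(\<lambda>z. qval f (fst z) (snd z)) \<in> borel_measurable (step_space P)"
  unfolding step_space_def
  by (rule measurable_compose_countable[OF measurable_compose[OF measurable_fst measurable_qval[OF f]]
      measurable_snd])

end

section \<open>The process under a fixed policy and a fixed start\<close>

locale controlled_process = maintenance_mdp P for P :: "'m::finite maintenance_data" +
  fixes \<pi> :: "'m policy" and h\<^sub>0 :: "'m state"
  assumes policy: "\<pi> \<in> policies P" and start: "h\<^sub>0 \<in> space (state_space P)"
begin

lemma state_law_kernel: "state_law h\<^sub>0 t \<in> history_space P t \<rightarrow>\<^sub>M prob_algebra (state_space P)"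
proof (cases t)
  case 0
  have "return (state_space P) h\<^sub>0 \<in> space (prob_algebra (state_space P))"
    using start by (simp add: space_prob_algebra prob_space_return)
  then show ?thesis using 0 by (simp add: state_law_def[abs_def])
next
  case (Suc s)
  have "(\<lambda>w. w s) \<in> history_space P t \<rightarrow>\<^sub>M step_space P"
    using Suc by (intro measurable_component_singleton) simp
  from measurable_compose[OF this measurable_next_state_pair] show ?thesis
    using Suc by (simp add: state_law_def[abs_def])
qed

lemma action_kernel:
  "(\<lambda>z. measure_pmf (\<pi> t (fst z) (snd z)))
      \<in> history_space P t \<Otimes>\<^sub>M state_space P \<rightarrow>\<^sub>M prob_algebra (count_space UNIV)"
  using policy by (intro measurable_measure_pmf_finite) (auto simp: policies_def case_prod_beta')

definition choice :: "nat \<Rightarrow> (nat \<Rightarrow> 'm state \<times> 'm action) \<Rightarrow> 'm state \<Rightarrow>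
    ('m state \<times> 'm action) measure" where
  "choice t w h = distr (measure_pmf (\<pi> t w h)) (step_space P) (\<lambda>a. (h, a))"

lemma choice_kernel:
  "(\<lambda>z. choice t (fst z) (snd z)) \<in> history_space P t \<Otimes>\<^sub>M state_space P \<rightarrow>\<^sub>M prob_algebra (step_space P)"
  unfolding choice_def
proof (rule measurable_distr_prob_space2[OF action_kernel])
  show "(\<lambda>(z, a). (snd z, a)) \<in> (history_space P t \<Otimes>\<^sub>M state_space P) \<Otimes>\<^sub>M count_space UNIV
      \<rightarrow>\<^sub>M step_space P"
    unfolding step_space_def by measurable
qed

lemma step_kernel_alt: "step_kernel P \<pi> h\<^sub>0 t w = state_law h\<^sub>0 t w \<bind> choice t w"
  by (simp add: step_kernel_def state_law_def choice_def[abs_def])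

lemma measurable_step_kernel: "step_kernel P \<pi> h\<^sub>0 t \<in> history_space P t \<rightarrow>\<^sub>M prob_algebra (step_space P)"
  unfolding step_kernel_alt[abs_def]
  by (rule measurable_bind_prob_space2[OF state_law_kernel])
      (use choice_kernel in \<open>simp add: case_prod_beta'\<close>)

sublocale Ionescu_Tulcea "step_kernel P \<pi> h\<^sub>0" "\<lambda>_. step_space P"
proof (rule Ionescu_Tulcea.intro)
  fix i
  show "step_kernel P \<pi> h\<^sub>0 i \<in> history_space P i \<rightarrow>\<^sub>M subprob_algebra (step_space P)"
    by (rule measurable_prob_algebraD[OF measurable_step_kernel])
  fix x :: "nat \<Rightarrow> 'm state \<times> 'm action"
  assume "x \<in> space (history_space P i)"
  then show "prob_space (step_kernel P \<pi> h\<^sub>0 i x)"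
    using measurable_space[OF measurable_step_kernel] by (auto simp: space_prob_algebra)
qed

text \<open>The first \<open>n\<close> kernels composed from the empty history. A product over no
  coordinates has the constantly undefined function as its only point.\<close>

abbreviation history_law :: "nat \<Rightarrow> (nat \<Rightarrow> 'm state \<times> 'm action) measure" where
  "history_law n \<equiv> C 0 n (\<lambda>_. undefined)"

lemma undefined_in_history: "(\<lambda>_. undefined) \<in> space (history_space P 0)"
  by (simp add: space_PiM)

lemma sets_history_law: "sets (history_law n) = sets (history_space P n)"
  using sets_C[OF undefined_in_history, of n] by simp

lemma space_history_law: "space (history_law n) = space (history_space P n)"
  by (rule sets_eq_imp_space_eq[OF sets_history_law])

lemma nn_integral_history_law_Suc:
  assumes f: "f \<in> borel_measurable (history_space P (Suc n))"
  shows "(\<integral>\<^sup>+w. f w \<partial>history_law (Suc n))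
      = (\<integral>\<^sup>+w. \<integral>\<^sup>+z. f (w(n := z)) \<partial>step_kernel P \<pi> h\<^sub>0 n w \<partial>history_law n)"
proof -
  have "eP n \<in> history_law n \<rightarrow>\<^sub>M subprob_algebra (history_space P (Suc n))"
    using measurable_eP[of n] by (simp cong: measurable_cong_sets add: sets_history_law)
  then have "(\<integral>\<^sup>+w. f w \<partial>history_law (Suc n)) = (\<integral>\<^sup>+w. \<integral>\<^sup>+w'. f w' \<partial>eP n w \<partial>history_law n)"
    by (simp add: nn_integral_bind[OF f])
  also have "\<dots> = (\<integral>\<^sup>+w. \<integral>\<^sup>+z. f (w(n := z)) \<partial>step_kernel P \<pi> h\<^sub>0 n w \<partial>history_law n)"
    by (intro nn_integral_cong nn_integral_eP f) (simp add: space_history_law)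
  finally show ?thesis .
qed

lemma nn_integral_step_kernel:
  assumes w: "w \<in> space (history_space P n)" and f: "f \<in> borel_measurable (step_space P)"
  shows "(\<integral>\<^sup>+z. f z \<partial>step_kernel P \<pi> h\<^sub>0 n w) = (\<integral>\<^sup>+h. \<integral>\<^sup>+a. f (h, a) \<partial>\<pi> n w h \<partial>state_law h\<^sub>0 n w)"
proof -
  have sets: "sets (state_law h\<^sub>0 n w) = sets (state_space P)"
    using measurable_space[OF state_law_kernel w] by (simp add: space_prob_algebra)
  have "choice n w \<in> state_space P \<rightarrow>\<^sub>M prob_algebra (step_space P)"
    using measurable_compose[OF measurable_Pair1'[OF w] choice_kernel] by simp
  then have "choice n w \<in> state_law h\<^sub>0 n w \<rightarrow>\<^sub>M subprob_algebra (step_space P)"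
    using sets by (simp cong: measurable_cong_sets add: measurable_prob_algebraD)
  then have "(\<integral>\<^sup>+z. f z \<partial>step_kernel P \<pi> h\<^sub>0 n w) = (\<integral>\<^sup>+h. \<integral>\<^sup>+z. f z \<partial>choice n w h \<partial>state_law h\<^sub>0 n w)"
    unfolding step_kernel_alt by (rule nn_integral_bind[OF f])
  also have "\<dots> = (\<integral>\<^sup>+h. \<integral>\<^sup>+a. f (h, a) \<partial>\<pi> n w h \<partial>state_law h\<^sub>0 n w)"
  proof (rule nn_integral_cong)
    fix h assume "h \<in> space (state_law h\<^sub>0 n w)"
    then have "h \<in> space (state_space P)" using sets by (auto dest: sets_eq_imp_space_eq)
    then have "(\<lambda>a. (h, a)) \<in> measure_pmf (\<pi> n w h) \<rightarrow>\<^sub>M step_space P"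
      by (simp add: step_space_def space_pair_measure measurable_pmf_measure1)
    then show "(\<integral>\<^sup>+z. f z \<partial>choice n w h) = (\<integral>\<^sup>+a. f (h, a) \<partial>\<pi> n w h)"
      unfolding choice_def using f by (simp add: nn_integral_distr)
  qed
  finally show ?thesis .
qed

section \<open>Finite-horizon costs of the policy\<close>

definition partial_cost :: "nat \<Rightarrow> (nat \<Rightarrow> 'm state \<times> 'm action) \<Rightarrow> ennreal" where
  "partial_cost n w = (\<Sum>t<n. ennreal (discount P ^ t * cost P (fst (w t)) (snd (w t))))"

text \<open>Expected cost of the first \<open>n\<close> epochs plus the discounted terminal value
  \<open>f\<close> of the state at epoch \<open>n\<close>, before an action is chosen there. The
  choice \<open>f = 0\<close> gives the plain truncated cost, and \<open>n = 0\<close> gives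
  \<open>f\<close> at the start.\<close>

definition horizon_value :: "nat \<Rightarrow> ('m state \<Rightarrow> ennreal) \<Rightarrow> ennreal" where
  "horizon_value n f = (\<integral>\<^sup>+w. partial_cost n w + ennreal (discount P ^ n) * (\<integral>\<^sup>+h. f h
      \<partial>state_law h\<^sub>0 n w) \<partial>history_law n)"

lemma measurable_partial_cost:
  assumes "{..<n} \<subseteq> I"
  shows "partial_cost n \<in> borel_measurable (PiM I (\<lambda>_. step_space P))"
proof -
  have "(\<lambda>w. cost P (fst (w t)) (snd (w t)))
      \<in> borel_measurable (PiM I (\<lambda>_. step_space P))" if "t < n" for t
    using assms that by (intro measurable_compose[OF _ measurable_cost_pair]
        measurable_component_singleton) auto
  then show ?thesis
    unfolding partial_cost_def[abs_def] by (intro borel_measurable_sum) auto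
qed

lemma measurable_nn_integral_state_law:
  "f \<in> borel_measurable (state_space P) \<Longrightarrow> (\<lambda>w. \<integral>\<^sup>+h. f h \<partial>state_law h\<^sub>0 n w)
      \<in> borel_measurable (history_space P n)"
  by (rule measurable_compose[OF measurable_prob_algebraD[OF state_law_kernel]
      nn_integral_measurable_subprob_algebra])

lemma horizon_value_0:
  assumes f: "f \<in> borel_measurable (state_space P)"
  shows "horizon_value 0 f = f h\<^sub>0"
proof -
  have "horizon_value 0 f = (\<integral>\<^sup>+w. f h\<^sub>0 \<partial>history_law 0)"
    using start f by (simp add: horizon_value_def partial_cost_def state_law_def nn_integral_return
        del: C.simps)
  then show ?thesis
    by (simp add: nn_integral_return undefined_in_history)
qed

lemma horizon_value_Suc:
  assumes f: "f \<in> borel_measurable (state_space P)"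
  shows "horizon_value (Suc n) f = (\<integral>\<^sup>+w. partial_cost n w +
     ennreal (discount P ^ n) * (\<integral>\<^sup>+h. \<integral>\<^sup>+a. qval f h a \<partial>\<pi> n w h \<partial>state_law h\<^sub>0 n w) \<partial>history_law n)"
proof -
  let ?F = "\<lambda>w. partial_cost (Suc n) w + ennreal (discount P ^ Suc n) * (\<integral>\<^sup>+h. f h
      \<partial>state_law h\<^sub>0 (Suc n) w)"
  have "?F \<in> borel_measurable (history_space P (Suc n))"
    using measurable_partial_cost[of "Suc n" "{0..<Suc n}"
        , OF equalityD2[OF atLeast0LessThan]] measurable_nn_integral_state_law[OF f, of "Suc n"]
    by (intro borel_measurable_add borel_measurable_times_ennreal) auto
  then have "horizon_value (Suc n) f = (\<integral>\<^sup>+w. \<integral>\<^sup>+z. ?F (w(n := z)) \<partial>step_kernel P \<pi> h\<^sub>0 n w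
      \<partial>history_law n)"
    unfolding horizon_value_def by (rule nn_integral_history_law_Suc)
  also have "\<dots> = (\<integral>\<^sup>+w. partial_cost n w +
     ennreal (discount P ^ n) * (\<integral>\<^sup>+h. \<integral>\<^sup>+a. qval f h a \<partial>\<pi> n w h \<partial>state_law h\<^sub>0 n w) \<partial>history_law n)"
  proof (rule nn_integral_cong)
    fix w assume "w \<in> space (history_law n)"
    then have w: "w \<in> space (history_space P n)" by (simp add: space_history_law)
    have q: "(\<lambda>z. qval f (fst z) (snd z)) \<in> borel_measurable (step_kernel P \<pi> h\<^sub>0 n w)"
      using measurable_qval_pair[OF f] sets_P[OF w] by (simp cong: measurable_cong_sets)
    have "partial_cost n (w(n := z)) = partial_cost n w" for z
      by (simp add: partial_cost_def)
    \<comment> \<open>The cost at epoch \<open>n\<close> and the terminal value at epoch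
      \<open>n + 1\<close> combine to exactly one lookahead \<open>qval f\<close>, since the law of
      the next state depends on the last pair \<open>z\<close> alone.\<close>
    then have "?F (w(n := z)) = partial_cost n w + ennreal (discount P ^ n) * qval f (fst z) (snd z)"
        for z
      using discount_nonneg cost_nonneg[of "fst z" "snd z"]
      by (simp add: partial_cost_def qval_def state_law_def distrib_left add.assoc ennreal_mult mult_ac)
    then have "(\<integral>\<^sup>+z. ?F (w(n := z)) \<partial>step_kernel P \<pi> h\<^sub>0 n w) =
       (\<integral>\<^sup>+z. partial_cost n w + ennreal (discount P ^ n) * qval f (fst z) (snd z)
           \<partial>step_kernel P \<pi> h\<^sub>0 n w)"
      by simp
    also have "\<dots> = partial_cost n w + ennreal (discount P ^ n) * (\<integral>\<^sup>+z. qval f (fst z) (snd z)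
        \<partial>step_kernel P \<pi> h\<^sub>0 n w)"
      using q prob_space.emeasure_space_1[OF prob_space_P[OF w]]
          by (simp add: nn_integral_add nn_integral_cmult)
    also have "(\<integral>\<^sup>+z. qval f (fst z) (snd z) \<partial>step_kernel P \<pi> h\<^sub>0 n w)
        = (\<integral>\<^sup>+h. \<integral>\<^sup>+a. qval f h a \<partial>\<pi> n w h \<partial>state_law h\<^sub>0 n w)"
      by (simp add: nn_integral_step_kernel[OF w measurable_qval_pair[OF f]])
    finally show "(\<integral>\<^sup>+z. ?F (w(n := z)) \<partial>step_kernel P \<pi> h\<^sub>0 n w) = partial_cost n w +
       ennreal (discount P ^ n) * (\<integral>\<^sup>+h. \<integral>\<^sup>+a. qval f h a \<partial>\<pi> n w h \<partial>state_law h\<^sub>0 n w)" .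
  qed
  finally show ?thesis .
qed

lemma space_state_law:
  "w \<in> space (history_space P n) \<Longrightarrow> space (state_law h\<^sub>0 n w) = space (state_space P)"
  using measurable_space[OF state_law_kernel]
      by (auto simp: space_prob_algebra dest: sets_eq_imp_space_eq)

lemma horizon_value_mono:
  assumes "\<And>h. h \<in> space (state_space P) \<Longrightarrow> f h \<le> g h"
  shows "horizon_value n f \<le> horizon_value n g"
  unfolding horizon_value_def
  by (intro nn_integral_mono add_left_mono mult_left_mono)
      (auto simp: space_history_law space_state_law assms)

text \<open>Given history and state, the policy averages \<open>qval f\<close> over admissible
  actions, and an average is at least the minimum. Memory and randomisation therefore cannot beat a
  Bellman step.\<close>

lemma horizon_value_bellman_le:
  assumes f: "f \<in> borel_measurable (state_space P)"
  shows "horizon_value n (bellman f) \<le> horizon_value (Suc n) f"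
proof -
  have "bellman f h \<le> (\<integral>\<^sup>+a. qval f h a \<partial>\<pi> n w h)"
    if "w \<in> space (history_space P n)" "h \<in> space (state_space P)" for w h
  proof -
    have "set_pmf (\<pi> n w h) \<subseteq> actions P h" using policy that by (auto simp: policies_def)
    then have "(\<integral>\<^sup>+a. bellman f h \<partial>\<pi> n w h) \<le> (\<integral>\<^sup>+a. qval f h a \<partial>\<pi> n w h)"
      by (intro nn_integral_mono_AE) (auto simp: AE_measure_pmf_iff intro: bellman_le)
    then show ?thesis by simp
  qed
  then show ?thesis
    unfolding horizon_value_Suc[OF f] unfolding horizon_value_def
    by (intro nn_integral_mono add_left_mono mult_left_mono)
        (auto simp: space_history_law space_state_law)
qed

text \<open>Each epoch played by the policy uses up one Bellman step of the terminal value.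
  \<open>k\<close> stays free because the induction moves steps from the terminal iterate to the
  policy; only \<open>k = 0\<close> is used afterwards.\<close>

lemma val_iter_le_horizon_value: "val_iter (n + k) h\<^sub>0 \<le> horizon_value n (val_iter k)"
proof (induction n arbitrary: k)
  case 0
  then show ?case by (simp add: horizon_value_0 measurable_val_iter)
next
  case (Suc n)
  have "val_iter (Suc n + k) h\<^sub>0 \<le> horizon_value n (bellman (val_iter k))"
    using Suc[of "Suc k"] by (simp add: val_iter_Suc)
  also have "\<dots> \<le> horizon_value (Suc n) (val_iter k)"
    by (rule horizon_value_bellman_le[OF measurable_val_iter])
  finally show ?case .
qed

definition total_cost :: ennreal where
  "total_cost = (SUP n. horizon_value n (\<lambda>_. 0))"

lemma opt_val_le_total_cost: "opt_val h\<^sub>0 \<le> total_cost"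
  unfolding opt_val_def total_cost_def
  using val_iter_le_horizon_value[of _ 0] by (intro SUP_mono) (auto simp: val_iter_0)

lemma total_cost_le_opt_val:
  assumes greedy: "\<And>n w h. h \<in> space (state_space P) \<Longrightarrow> (\<integral>\<^sup>+a. qval opt_val h a \<partial>\<pi> n w h) \<le> opt_val h"
  shows "total_cost \<le> opt_val h\<^sub>0"
proof -
  have "horizon_value n opt_val \<le> opt_val h\<^sub>0" for n
  proof (induction n)
    case 0
    then show ?case by (simp add: horizon_value_0 measurable_opt_val)
  next
    case (Suc n)
    have "horizon_value (Suc n) opt_val \<le> horizon_value n opt_val"
      unfolding horizon_value_Suc[OF measurable_opt_val] unfolding horizon_value_def
      by (intro nn_integral_mono add_left_mono mult_left_mono)
          (auto simp: space_history_law space_state_law greedy)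
    then show ?case using Suc by simp
  qed
  \<comment> \<open>Replacing the terminal value \<open>opt_val\<close> by 0 can only lower the
    cost, so no vanishing of the discounted remainder has to be shown.\<close>
  then show ?thesis
    unfolding total_cost_def by (intro SUP_least) (rule order_trans[OF horizon_value_mono], simp)
qed

section \<open>Passage to the infinite trajectory\<close>

text \<open>On an initial segment of epochs the embedding into the longer product is the identity,
  so the marginal of the projective family is the composed law itself.\<close>

lemma CI_atLeastLessThan: "CI {0..<n} = history_law n"
proof (rule measure_eqI)
  show "sets (CI {0..<n}) = sets (history_law n)"
    by (simp add: CI_def sets_history_law)
  fix X assume "X \<in> sets (CI {0..<n})"
  then have X: "X \<in> sets (history_space P n)" by (simp add: CI_def)
  then show "emeasure (CI {0..<n}) X = emeasure (history_law n) X"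
    by (simp add: emeasure_CI[of "{0..<n}" n X] prod_emb_id sets.sets_into_space[OF X
        , unfolded space_PiM])
qed

lemma sets_trajectory: "sets (trajectory P \<pi> h\<^sub>0) = sets (PiM UNIV (\<lambda>_. step_space P))"
  by (simp add: trajectory_def PF.sets_lim)

lemma measurable_restrict_trajectory: "(\<lambda>w. restrict w {0..<n})
    \<in> trajectory P \<pi> h\<^sub>0 \<rightarrow>\<^sub>M history_space P n"
  using measurable_restrict_subset[of "{0..<n}" UNIV "\<lambda>_. step_space P"] sets_trajectory
  by (simp cong: measurable_cong_sets)

lemma distr_trajectory: "distr (trajectory P \<pi> h\<^sub>0) (history_space P n) (\<lambda>w. restrict w {0..<n})
    = history_law n"
  using distr_lim[of "{0..<n}"] by (simp add: trajectory_def CI_atLeastLessThan)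

text \<open>Images preserve total mass, so the marginal on the empty history already decides the
  matter.\<close>

lemma prob_space_trajectory: "prob_space (trajectory P \<pi> h\<^sub>0)"
  using measurable_restrict_trajectory[of 0]
  by (rule prob_space_distrD) (simp only: distr_trajectory prob_space_C[OF undefined_in_history])

lemma nn_integral_partial_cost: "(\<integral>\<^sup>+w. partial_cost n w \<partial>trajectory P \<pi> h\<^sub>0) = horizon_value n (\<lambda>_. 0)"
proof -
  have "(\<integral>\<^sup>+w. partial_cost n w \<partial>trajectory P \<pi> h\<^sub>0)
      = (\<integral>\<^sup>+w. partial_cost n (restrict w {0..<n}) \<partial>trajectory P \<pi> h\<^sub>0)"
    by (simp add: partial_cost_def)
  also have "\<dots> = (\<integral>\<^sup>+w. partial_cost n w
      \<partial>distr (trajectory P \<pi> h\<^sub>0) (history_space P n) (\<lambda>w. restrict w {0..<n}))"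
    using measurable_partial_cost[of n "{0..<n}", OF equalityD2[OF atLeast0LessThan]]
    by (intro nn_integral_distr[OF measurable_restrict_trajectory, symmetric]) simp
  finally show ?thesis by (simp add: distr_trajectory horizon_value_def)
qed

text \<open>Stage costs are non-negative and dominated by a geometric series. The real series is
  thus the supremum of the partial costs, and monotone convergence reduces it to the finite-horizon
  values.\<close>

lemma policy_cost_eq: "policy_cost P \<pi> h\<^sub>0 = enn2real total_cost"
  and total_cost_le: "total_cost \<le> ennreal (\<Sum>t. discount P ^ t * cost_bound)"
proof -
  let ?c = "\<lambda>t w. discount P ^ t * cost P (fst (w t)) (snd (w t))"
  have c_nonneg: "0 \<le> ?c t w" for t w
    using discount_nonneg cost_nonneg by simp
  have c_le: "?c t w \<le> discount P ^ t * cost_bound" for t w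
    using discount_nonneg cost_le_bound by (intro mult_left_mono) auto
  have geo: "summable (\<lambda>t. discount P ^ t * cost_bound)"
    using discount_nonneg discount_less_1 by (intro summable_mult2 summable_geometric) auto
  have summable: "summable (\<lambda>t. ?c t w)" for w
    by (rule summable_comparison_test[OF _ geo]) (use c_nonneg c_le in auto)
  have ennreal_suminf: "ennreal (\<Sum>t. ?c t w) = (SUP n. partial_cost n w)" for w
    unfolding partial_cost_def suminf_eq_SUP[symmetric]
    using c_nonneg summable by (intro suminf_ennreal2[symmetric]) auto
  have part_meas: "partial_cost n \<in> borel_measurable (trajectory P \<pi> h\<^sub>0)" for n
    using measurable_partial_cost[of n UNIV] sets_trajectory by (simp cong: measurable_cong_sets)
  have "incseq partial_cost"
    by (rule incseq_SucI) (simp add: le_fun_def partial_cost_def)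
  then have total: "(\<integral>\<^sup>+w. ennreal (\<Sum>t. ?c t w) \<partial>trajectory P \<pi> h\<^sub>0) = total_cost"
    unfolding ennreal_suminf total_cost_def nn_integral_partial_cost[symmetric]
    by (rule nn_integral_monotone_convergence_SUP) (rule part_meas)
  have c_meas: "?c t \<in> borel_measurable (trajectory P \<pi> h\<^sub>0)" for t
  proof -
    have "(\<lambda>w. cost P (fst (w t)) (snd (w t))) \<in> borel_measurable (PiM UNIV (\<lambda>_. step_space P))"
      by (intro measurable_compose[OF _ measurable_cost_pair] measurable_component_singleton) simp
    then show ?thesis using sets_trajectory by (simp cong: measurable_cong_sets)
  qed
  have "policy_cost P \<pi> h\<^sub>0 = enn2real (\<integral>\<^sup>+w. ennreal (\<Sum>t. ?c t w) \<partial>trajectory P \<pi> h\<^sub>0)"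
    unfolding policy_cost_def using c_meas c_nonneg summable
    by (intro integral_eq_nn_integral borel_measurable_suminf AE_I2 suminf_nonneg)
  then show "policy_cost P \<pi> h\<^sub>0 = enn2real total_cost" by (simp add: total)
  have "(\<integral>\<^sup>+w. ennreal (\<Sum>t. discount P ^ t * cost_bound) \<partial>trajectory P \<pi> h\<^sub>0)
      = ennreal (\<Sum>t. discount P ^ t * cost_bound)"
    by (simp only: nn_integral_const prob_space.emeasure_space_1[OF prob_space_trajectory] mult_1_right)
  moreover have "(\<integral>\<^sup>+w. ennreal (\<Sum>t. ?c t w) \<partial>trajectory P \<pi> h\<^sub>0)
      \<le> (\<integral>\<^sup>+w. ennreal (\<Sum>t. discount P ^ t * cost_bound) \<partial>trajectory P \<pi> h\<^sub>0)"
    by (intro nn_integral_mono ennreal_leI suminf_le c_le summable geo)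
  ultimately show "total_cost \<le> ennreal (\<Sum>t. discount P ^ t * cost_bound)" by (simp add: total)
qed

end

section \<open>Attainment of the optimum and monotonicity of \<open>Q\<close>\<close>

context maintenance_mdp
begin

lemma greedy_policy:
  obtains \<pi> where "\<pi> \<in> policies P"
    "\<And>n w h. h \<in> space (state_space P) \<Longrightarrow> (\<integral>\<^sup>+a. qval opt_val h a \<partial>\<pi> n w h) \<le> opt_val h"
proof -
  have ne: "actions P h \<noteq> {}" for h using UNIV_in_actions by auto
  have "\<exists>g \<in> state_space P \<rightarrow>\<^sub>M count_space UNIV. \<forall>h\<in>space (state_space P).
      g h \<in> actions P h \<and> (\<forall>b\<in>actions P h. qval opt_val h (g h) \<le> qval opt_val h b)"
    by (rule measurable_finite_minimizer[OF measurable_qval[OF measurable_opt_val] measurable_actions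
        ne])
  then obtain g where g: "g \<in> state_space P \<rightarrow>\<^sub>M count_space UNIV"
    and g_min: "\<forall>h\<in>space (state_space P).
      g h \<in> actions P h \<and> (\<forall>b\<in>actions P h. qval opt_val h (g h) \<le> qval opt_val h b)"
    by (elim bexE)
  \<comment> \<open>A stationary deterministic policy; membership in \<open>policies P\<close> rests
    on the measurability of the selector \<open>g\<close>.\<close>
  define \<pi> :: "'m policy" where "\<pi> = (\<lambda>_ _ h. return_pmf (g h))"
  have "(\<lambda>(w, h). pmf (\<pi> t w h) a) \<in> borel_measurable (history_space P t \<Otimes>\<^sub>M state_space P)" for t a
  proof -
    have "(\<lambda>h. indicator {a} (g h) :: real) \<in> borel_measurable (state_space P)"
      by (rule measurable_compose[OF g]) simp
    from measurable_compose[OF measurable_snd this] show ?thesis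
      by (simp add: \<pi>_def case_prod_beta')
  qed
  then have "\<pi> \<in> policies P"
    using g_min by (auto simp: policies_def \<pi>_def)
  moreover have "(\<integral>\<^sup>+a. qval opt_val h a \<partial>\<pi> n w h) \<le> opt_val h" if h: "h
      \<in> space (state_space P)" for n w h
  proof -
    have "(\<integral>\<^sup>+a. qval opt_val h a \<partial>\<pi> n w h) = qval opt_val h (g h)"
      by (simp add: \<pi>_def nn_integral_return)
    also have "\<dots> \<le> bellman opt_val h"
      unfolding bellman_def by (rule INF_greatest) (use g_min h in auto)
    also have "\<dots> \<le> opt_val h" by (rule bellman_opt_val_le[OF h])
    finally show ?thesis .
  qed
  ultimately show ?thesis by (rule that)
qed

lemma V_eq_opt_val:
  assumes h: "h \<in> space (state_space P)"
  shows "V P h = enn2real (opt_val h)" and opt_val_le: "opt_val h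
      \<le> ennreal (\<Sum>t. discount P ^ t * cost_bound)"
proof -
  obtain \<pi> where \<pi>: "\<pi> \<in> policies P"
    "\<And>n w h. h \<in> space (state_space P) \<Longrightarrow> (\<integral>\<^sup>+a. qval opt_val h a \<partial>\<pi> n w h) \<le> opt_val h"
    by (rule greedy_policy) blast
  interpret \<pi>: controlled_process P \<pi> h
    by unfold_locales (rule \<pi> h)+
  have eq: "\<pi>.total_cost = opt_val h"
    by (intro antisym \<pi>.total_cost_le_opt_val \<pi>(2) \<pi>.opt_val_le_total_cost)
  show "opt_val h \<le> ennreal (\<Sum>t. discount P ^ t * cost_bound)" using \<pi>.total_cost_le eq by simp
  have "enn2real (opt_val h) \<le> policy_cost P \<pi>' h" if "\<pi>' \<in> policies P" for \<pi>'
  proof -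
    interpret \<pi>': controlled_process P \<pi>' h
      by unfold_locales (rule that h)+
    show ?thesis
      unfolding \<pi>'.policy_cost_eq by (rule enn2real_mono[OF \<pi>'.opt_val_le_total_cost le_less_trans[OF
          \<pi>'.total_cost_le ennreal_less_top]])
  qed
  \<comment> \<open>The real infimum is attained by the greedy policy, so it is evaluated as a
    minimum, without a separate argument that the costs are bounded below.\<close>
  then show "V P h = enn2real (opt_val h)"
    unfolding V_def using \<pi>(1) \<pi>.policy_cost_eq eq
    by (intro cInf_eq_minimum) (auto simp: image_iff intro!: bexI[of _ \<pi>])
qed

text \<open>\<open>V\<close> is an infimum over a large family of policies and gets its
  measurability only through \<open>opt_val\<close>. The two agree on the state space, which carries
  the transition law, and the finiteness of \<open>opt_val\<close> there makes
  \<open>enn2real\<close> reversible.\<close>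

lemma integral_V_next_state:
  assumes h: "h \<in> space (state_space P)"
  shows "(\<integral>h'. V P h' \<partial>next_state P h a) = enn2real (\<integral>\<^sup>+h'. opt_val h' \<partial>next_state P h a)"
proof -
  have sets: "sets (next_state P h a) = sets (state_space P)"
    using measurable_space[OF next_state_kernel h] by (auto simp: space_prob_algebra)
  then have space: "space (next_state P h a) = space (state_space P)" by (rule sets_eq_imp_space_eq)
  have "(\<integral>h'. V P h' \<partial>next_state P h a) = (\<integral>h'. enn2real (opt_val h') \<partial>next_state P h a)"
    by (intro Bochner_Integration.integral_cong) (simp_all add: space V_eq_opt_val)
  also have "\<dots> = enn2real (\<integral>\<^sup>+h'. ennreal (enn2real (opt_val h')) \<partial>next_state P h a)"
    using measurable_opt_val sets by (intro integral_eq_nn_integral) (auto cong: measurable_cong_sets)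
  also have "(\<integral>\<^sup>+h'. ennreal (enn2real (opt_val h')) \<partial>next_state P h a)
      = (\<integral>\<^sup>+h'. opt_val h' \<partial>next_state P h a)"
    by (intro nn_integral_cong ennreal_enn2real)
        (simp add: space le_less_trans[OF opt_val_le ennreal_less_top])
  finally show ?thesis .
qed

text \<open>\<open>enn2real\<close> sends \<open>\<top>\<close> to 0 and is monotone only below
  \<open>\<top>\<close>; this is why the expectation at the larger state is bounded before the
  inequality is brought back to the reals.\<close>

lemma Q_mono:
  assumes h: "h \<in> space (state_space P)" "h' \<in> space (state_space P)" "state_le h h'"
  shows "Q P h a \<le> Q P h' a"
proof -
  have "(\<integral>\<^sup>+z. opt_val z \<partial>next_state P h' a) < \<top>"
  proof -
    have "prob_space (next_state P h' a)" "space (next_state P h' a) = space (state_space P)"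
      using measurable_space[OF next_state_kernel h(2)]
          by (auto simp: space_prob_algebra dest: sets_eq_imp_space_eq)
    then have "(\<integral>\<^sup>+z. opt_val z \<partial>next_state P h' a)
        \<le> (\<integral>\<^sup>+z. ennreal (\<Sum>t. discount P ^ t * cost_bound) \<partial>next_state P h' a)"
      by (intro nn_integral_mono) (simp add: opt_val_le)
    also have "\<dots> < \<top>"
      using prob_space.emeasure_space_1[OF \<open>prob_space (next_state P h' a)\<close>] by simp
    finally show ?thesis .
  qed
  then have "(\<integral>z. V P z \<partial>next_state P h a) \<le> (\<integral>z. V P z \<partial>next_state P h' a)"
    unfolding integral_V_next_state[OF h(1)] integral_V_next_state[OF h(2)]
    by (intro enn2real_mono nn_integral_next_state_mono h measurable_opt_val opt_val_state_mono)
  then show ?thesis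
    unfolding Q_def using cost_mono[OF h(3)] discount_nonneg by (intro add_mono mult_left_mono)
qed

end

section \<open>Comparison of all actions in the two states\<close>

theorem theorem2:
  fixes P :: "'m::finite maintenance_data"
    and x x' :: "'m state"
    and a :: "'m action"
  assumes "maintenance_mdp P"
    and "x \<in> space (state_space P)"
    and "x' \<in> space (state_space P)"
    and "optimal_action P x a"
    and "\<forall>m. level x' m = level x m"
    and "\<forall>m. a m \<longrightarrow> rate x' m \<ge> rate x m \<and> param x' m \<ge> param x m"
    and "\<forall>m. \<not> a m \<longrightarrow> rate x' m = rate x m \<and> param x' m = param x m"
    and "\<forall>m. param x' m \<ge> param x m \<longrightarrow>
           st_le (shock_dist P m (param x m)) (\<lambda>y. y) (shock_dist P m (param x' m)) (\<lambda>y. y)"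
  shows "optimal_action P x' a"
proof -
  interpret maintenance_mdp P by fact
  have actions: "actions P x' = actions P x"
    using assms(5) by (simp add: actions_def)
  \<comment> \<open>For machines that \<open>a\<close> leaves alone the parameters are equal, so the
    inequalities hold for every machine and the assumption on shock sizes can be invoked for each of
    them.\<close>
  have "rate x m \<le> rate x' m \<and> param x m \<le> param x' m" for m
    using assms(6,7) by (cases "a m") auto
  then have "machine_le m (x m) (x' m)" for m
    using assms(5,8) by (simp add: machine_le_def)
  then have "state_le x x'" by (simp add: state_le_def)
  have "machine_step m (x' m) (a m) = machine_step m (x m) (a m)" for m
  proof (cases "a m")
    case True
    then show ?thesis by (simp add: machine_step_def reset_dist_def)
  next
    case False
    \<comment> \<open>A machine kept by \<open>a\<close> has the same level, rate and parameter in
      both states, so its whole transition law coincides.\<close>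
    then have "x' m = x m" using assms(5,7) by (simp add: prod_eq_iff)
    then show ?thesis by simp
  qed
  then have "next_state P x' a = next_state P x a" by (simp add: next_state_alt)
  moreover have "cost P x' a = cost P x a" using assms(5) by (simp add: cost_def)
  ultimately have eq: "Q P x' a = Q P x a" by (simp add: Q_def)
  have a: "a \<in> actions P x" "\<And>b. b \<in> actions P x \<Longrightarrow> Q P x a \<le> Q P x b"
    using assms(4) by (auto simp: is_arg_min_linorder)
  have "Q P x' a \<le> Q P x' b" if "b \<in> actions P x" for b
    unfolding eq using a(2)[OF that] Q_mono[OF assms(2,3) \<open>state_le x x'\<close>] by (rule order_trans)
  then show ?thesis
    using a(1) by (simp add: is_arg_min_linorder actions)
qed

end
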